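(* Let $R$ be an integral domain of (Krull) dimension 1. Then the following properties hold: (1) Each matrix in $Um(\mathbb{M}_2(R))$ with nonzero determinant is simply extendable. (2) $R$ is an $SE_2^{\triangle}$ ring, a $V_2$ ring, and a $Z_2$ ring. (3) $R$ is a $\Pi_2$ ring iff it is an $SE_2$ (or an $E_2$) ring, and iff $Pic(R)$ is trivial. (4) Assume $R$ is a Dedekind domain. Then $R$ is a $\Pi_2$ ring iff it is a principal ideal domain.
   Context: $Um(R^n)$ is the set of $n$-tuples generating the unit ideal of $R$; $Um(\mathbb{M}_2(R))$ is the set of $2\times2$ matrices whose entries generate the unit ideal. $A\in\mathbb{M}_2(R)$ is extendable if there is $A^+\in SL_3(R)$ whose upper-left $2\times 2$ block is $A$; it is simply extendable if $A^+$ can be chosen with $(3,3)$ entry $0$. $Pic(R)$ is the Picard group of $R$. A commutative ring $R$ is: a $\Pi_2$ ring if each $A\in Um(\mathbb{M}_2(R))$ with $\det(A)=0$ is extendable; an $E_2$ (resp. $SE_2$) ring if each matrix in $Um(\mathbb{M}_2(R))$ is extendable (resp. simply extendable); an $SE_2^{\triangle}$ ring if each upper (or lower) triangular matrix in $Um(\mathbb{M}_2(R))$ is simply extendable; a $V_2$ ring if for each $(a,b,c)\in Um(R^3)$ there exists $(x,y,z,w)\in R^4$ with $(1-ax)(1-cw)=y(b+acz)$ and $xw=yz$; a $Z_2$ ring if for each $A\in Um(\mathbb{M}_2(R))$ there exists $B\in Um(\mathbb{M}_2(R))$ with $\det(B)=0$ such that all entries of $A-B$ lie in $R\det(A)$.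 *)

theory Defs
  imports
    "HOL-Analysis.Determinants"
    "HOL-Algebra.Algebra"
    "HOL-Algebra.Algebraic_Closure_Type"
    "HOL-Computational_Algebra.Polynomial_Factorial"
    "HOL-Library.Extended_Nat"
begin

text \<open>
  The ring is a type of class \<open>comm_ring_1\<close> (\<open>idom\<close> for integral domains). Ideals and modules are
  those of HOL-Algebra over the ring structure \<open>ring_of_type_algebra\<close>, whose carrier is the whole type.
\<close>

abbreviation ring_of :: "'a::comm_ring_1 itself \<Rightarrow> 'a ring"
  where "ring_of _ \<equiv> ring_of_type_algebra"


section \<open>Unimodular tuples and matrices, extendability\<close>

definition Um :: "('a::comm_ring_1 ^ 'n) set"
  where "Um = {v. Idl\<^bsub>ring_of TYPE('a)\<^esub> (range (\<lambda>i. v $ i)) = UNIV}"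

definition UmM2 :: "('a::comm_ring_1 ^ 2 ^ 2) set"
  where "UmM2 = {A. Idl\<^bsub>ring_of TYPE('a)\<^esub> (range (\<lambda>(i, j). A $ i $ j)) = UNIV}"

definition SL3 :: "('a::comm_ring_1 ^ 3 ^ 3) set"
  where "SL3 = {A. det A = 1}"

text \<open>
  The indices \<open>1\<close>, \<open>2\<close> below are elements of the finite types \<open>2\<close> and \<open>3\<close>, whose elements are
  \<open>1, 2\<close> and \<open>1, 2, 3\<close> respectively (in these types \<open>2 = 0\<close> and \<open>3 = 0\<close>).
\<close>

definition upper_left_block :: "'a ^ 3 ^ 3 \<Rightarrow> 'a ^ 2 ^ 2 \<Rightarrow> bool"
  where "upper_left_block B A \<longleftrightarrow>
    B $ 1 $ 1 = A $ 1 $ 1 \<and> B $ 1 $ 2 = A $ 1 $ 2 \<and>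
    B $ 2 $ 1 = A $ 2 $ 1 \<and> B $ 2 $ 2 = A $ 2 $ 2"

definition extendable :: "'a::comm_ring_1 ^ 2 ^ 2 \<Rightarrow> bool"
  where "extendable A \<longleftrightarrow> (\<exists>B\<in>SL3. upper_left_block B A)"

definition simply_extendable :: "'a::comm_ring_1 ^ 2 ^ 2 \<Rightarrow> bool"
  where "simply_extendable A \<longleftrightarrow> (\<exists>B\<in>SL3. upper_left_block B A \<and> B $ 3 $ 3 = 0)"


section \<open>The ring properties\<close>

definition Pi2_ring :: "'a::comm_ring_1 itself \<Rightarrow> bool"
  where "Pi2_ring _ \<longleftrightarrow> (\<forall>A\<in>(UmM2 :: ('a ^ 2 ^ 2) set). det A = 0 \<longrightarrow> extendable A)"

definition E2_ring :: "'a::comm_ring_1 itself \<Rightarrow> bool"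
  where "E2_ring _ \<longleftrightarrow> (\<forall>A\<in>(UmM2 :: ('a ^ 2 ^ 2) set). extendable A)"

definition SE2_ring :: "'a::comm_ring_1 itself \<Rightarrow> bool"
  where "SE2_ring _ \<longleftrightarrow> (\<forall>A\<in>(UmM2 :: ('a ^ 2 ^ 2) set). simply_extendable A)"

definition SE2_tri_ring :: "'a::comm_ring_1 itself \<Rightarrow> bool"
  where "SE2_tri_ring _ \<longleftrightarrow>
    (\<forall>A\<in>(UmM2 :: ('a ^ 2 ^ 2) set). A $ 2 $ 1 = 0 \<or> A $ 1 $ 2 = 0 \<longrightarrow> simply_extendable A)"

definition V2_ring :: "'a::comm_ring_1 itself \<Rightarrow> bool"
  where "V2_ring _ \<longleftrightarrow>
    (\<forall>a b c :: 'a. vector [a, b, c] \<in> (Um :: ('a ^ 3) set) \<longrightarrow>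
      (\<exists>x y z w. (1 - a * x) * (1 - c * w) = y * (b + a * c * z) \<and> x * w = y * z))"

definition Z2_ring :: "'a::comm_ring_1 itself \<Rightarrow> bool"
  where "Z2_ring _ \<longleftrightarrow>
    (\<forall>A\<in>(UmM2 :: ('a ^ 2 ^ 2) set). \<exists>B\<in>UmM2. det B = 0 \<and> (\<forall>i j. det A dvd (A - B) $ i $ j))"


section \<open>Krull dimension and Dedekind domains\<close>

definition krull_dim :: "'a ring \<Rightarrow> enat"
  where "krull_dim R = Sup {enat n | n. \<exists>P :: nat \<Rightarrow> 'a set.
    (\<forall>i\<le>n. primeideal (P i) R) \<and> (\<forall>i<n. P i \<subset> P (Suc i))}"

definition integrally_closed :: "'a::idom itself \<Rightarrow> bool"
  where "integrally_closed _ \<longleftrightarrow>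
    (\<forall>(x :: 'a fract) (p :: 'a poly).
      lead_coeff p = 1 \<and> poly (map_poly to_fract p) x = 0 \<longrightarrow> x \<in> range to_fract)"

definition dedekind_domain :: "'a::idom itself \<Rightarrow> bool"
  where "dedekind_domain _ \<longleftrightarrow>
    noetherian_ring (ring_of TYPE('a)) \<and> integrally_closed TYPE('a) \<and>
    (\<forall>P. primeideal P (ring_of TYPE('a)) \<and> P \<noteq> {0} \<longrightarrow> maximalideal P (ring_of TYPE('a)))"


section \<open>The Picard group\<close>

definition module_hom :: "'a ring \<Rightarrow> ('a, 'm) module \<Rightarrow> ('a, 'n) module \<Rightarrow> ('m \<Rightarrow> 'n) set"
  where "module_hom R M N = {f \<in> carrier M \<rightarrow> carrier N.
    (\<forall>x\<in>carrier M. \<forall>y\<in>carrier M. f (x \<oplus>\<^bsub>M\<^esub> y) = f x \<oplus>\<^bsub>N\<^esub> f y) \<and>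
    (\<forall>a\<in>carrier R. \<forall>x\<in>carrier M. f (a \<odot>\<^bsub>M\<^esub> x) = a \<odot>\<^bsub>N\<^esub> f x)}"

definition module_iso :: "'a ring \<Rightarrow> ('a, 'm) module \<Rightarrow> ('a, 'n) module \<Rightarrow> bool"
  where "module_iso R M N \<longleftrightarrow> (\<exists>f\<in>module_hom R M N. bij_betw f (carrier M) (carrier N))"

text \<open>
  \<open>R\<^sup>n\<close>, as the sequences vanishing from index \<open>n\<close> on. The record type of modules extends that of
  rings; its fields \<open>mult\<close> and \<open>one\<close> play no role in the module axioms.
\<close>

definition free_module :: "'a ring \<Rightarrow> nat \<Rightarrow> ('a, nat \<Rightarrow> 'a) module"
  where "free_module R n = \<lparr>
    carrier = {v. (\<forall>i<n. v i \<in> carrier R) \<and> (\<forall>i\<ge>n. v i = \<zero>\<^bsub>R\<^esub>)},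
    monoid.mult = (\<lambda>v w i. v i \<otimes>\<^bsub>R\<^esub> w i),
    one = (\<lambda>i. if i < n then \<one>\<^bsub>R\<^esub> else \<zero>\<^bsub>R\<^esub>),
    ring.zero = (\<lambda>i. \<zero>\<^bsub>R\<^esub>),
    add = (\<lambda>v w i. v i \<oplus>\<^bsub>R\<^esub> w i),
    module.smult = (\<lambda>a v i. a \<otimes>\<^bsub>R\<^esub> v i)\<rparr>"

text \<open>A module is finitely generated projective iff it is a direct summand, i.e. a retract, of some \<open>R\<^sup>n\<close>.\<close>

definition fg_projective :: "'a ring \<Rightarrow> ('a, 'm) module \<Rightarrow> bool"
  where "fg_projective R M \<longleftrightarrow> Module.module R M \<and>
    (\<exists>n. \<exists>f\<in>module_hom R M (free_module R n). \<exists>g\<in>module_hom R (free_module R n) M.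
      \<forall>x\<in>carrier M. g (f x) = x)"

text \<open>
  The localization of \<open>M\<close> at the prime \<open>P\<close> is free of rank one over the localization of \<open>R\<close> at \<open>P\<close>,
  with the localizations unfolded. A basis can be taken of the form \<open>m/1\<close>; the first conjunct says
  that every \<open>x/1\<close> equals some \<open>(r/s)(m/1)\<close>, the second that \<open>(r/1)(m/1) = 0\<close> only if \<open>r/1 = 0\<close>.
\<close>

definition rank_one_at :: "'a ring \<Rightarrow> ('a, 'm) module \<Rightarrow> 'a set \<Rightarrow> bool"
  where "rank_one_at R M P \<longleftrightarrow> (\<exists>m\<in>carrier M.
    (\<forall>x\<in>carrier M. \<exists>s\<in>carrier R - P. \<exists>r\<in>carrier R. s \<odot>\<^bsub>M\<^esub> x = r \<odot>\<^bsub>M\<^esub> m) \<and>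
    (\<forall>r\<in>carrier R. (\<exists>s\<in>carrier R - P. s \<odot>\<^bsub>M\<^esub> (r \<odot>\<^bsub>M\<^esub> m) = \<zero>\<^bsub>M\<^esub>) \<longrightarrow>
      (\<exists>s\<in>carrier R - P. s \<otimes>\<^bsub>R\<^esub> r = \<zero>\<^bsub>R\<^esub>)))"

definition rank_one_projective :: "'a ring \<Rightarrow> ('a, 'm) module \<Rightarrow> bool"
  where "rank_one_projective R M \<longleftrightarrow>
    fg_projective R M \<and> (\<forall>P. primeideal P R \<longrightarrow> rank_one_at R M P)"

definition bilinear_maps ::
    "'a ring \<Rightarrow> ('a, 'm) module \<Rightarrow> ('a, 'n) module \<Rightarrow> ('a, 'l) module \<Rightarrow> ('m \<Rightarrow> 'n \<Rightarrow> 'l) set"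
  where "bilinear_maps R M N L = {b.
    (\<forall>x\<in>carrier M. (\<lambda>y. b x y) \<in> module_hom R N L) \<and>
    (\<forall>y\<in>carrier N. (\<lambda>x. b x y) \<in> module_hom R M L)}"

text \<open>
  \<open>T\<close> is a tensor product of \<open>M\<close> and \<open>N\<close> over \<open>R\<close>. The modules here have carriers in the type
  \<open>nat \<Rightarrow> 'a\<close>, which contains an isomorphic copy of every finitely generated module over a nonzero
  ring \<open>R\<close>, so for finitely generated \<open>M\<close> and \<open>N\<close> testing the universal property on such \<open>L\<close> is enough.
\<close>

definition tensor_product ::
    "'a ring \<Rightarrow> ('a, nat \<Rightarrow> 'a) module \<Rightarrow> ('a, nat \<Rightarrow> 'a) module \<Rightarrow> ('a, nat \<Rightarrow> 'a) module \<Rightarrow> bool"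
  where "tensor_product R M N T \<longleftrightarrow> Module.module R T \<and>
    (\<exists>b\<in>bilinear_maps R M N T. \<forall>L :: ('a, nat \<Rightarrow> 'a) module. \<forall>c\<in>bilinear_maps R M N L.
      Module.module R L \<longrightarrow>
      (\<exists>!f. f \<in> module_hom R T L \<inter> extensional (carrier T) \<and>
        (\<forall>x\<in>carrier M. \<forall>y\<in>carrier N. f (b x y) = c x y)))"

definition line_bundles :: "'a ring \<Rightarrow> ('a, nat \<Rightarrow> 'a) module set"
  where "line_bundles R = {M. rank_one_projective R M}"

definition iso_class :: "'a ring \<Rightarrow> ('a, nat \<Rightarrow> 'a) module \<Rightarrow> ('a, nat \<Rightarrow> 'a) module set"
  where "iso_class R M = {N \<in> line_bundles R. module_iso R M N}"

text \<open>
  The Picard group: isomorphism classes of finitely generated projective modules of constant rank one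
  under tensor product, with the class of \<open>R\<close> as unit element.
\<close>

definition Pic :: "'a ring \<Rightarrow> ('a, nat \<Rightarrow> 'a) module set monoid"
  where "Pic R = \<lparr>
    carrier = iso_class R ` line_bundles R,
    monoid.mult = (\<lambda>C D. {T \<in> line_bundles R. \<exists>M\<in>C. \<exists>N\<in>D. tensor_product R M N T}),
    one = iso_class R (free_module R 1)\<rparr>"

end

theory Submission
  imports Defs
begin

text \<open>
  A matrix \<open>A\<close> is simply extendable iff \<open>u A v = 1\<close> for some row \<open>u\<close> and column \<open>v\<close>. For \<open>d \<noteq> 0\<close> the
  ring \<open>R / d R\<close> is zero-dimensional, so for each \<open>b\<close> there is an \<open>e\<close> lying in exactly those primes
  over \<open>d\<close> that do not contain \<open>b\<close>. Such complements replace idempotents: with \<open>d = det A\<close> they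
  provide a \<open>v\<close> for which \<open>A v\<close> is unimodular.

  A line bundle is the image of a square matrix of rank one and trace one. Complements reduce the
  matrix to size \<open>2 \<times> 2\<close>, where the \<open>\<Pi>\<^sub>2\<close> property provides a generator; the ideals of a Dedekind domain,
  being invertible, are treated in the same way. Conversely, a unimodular \<open>A\<close> with \<open>det A = 0\<close> has
  a line bundle as column module, and a generator of it factors \<open>A\<close> as a column times a row.
\<close>

text \<open>Without a noetherian hypothesis infinitely many primes may lie over \<open>d\<close>, so
  vectors cannot be assembled prime by prime with the Chinese remainder theorem. A complement
  records only where an element vanishes, but unimodularity is tested at primes: in a sum such as
  \<open>b + c * e\<close>, with \<open>e\<close> a complement of \<open>b\<close>, at most one term
  survives at each prime over \<open>d\<close>. The determinant decides how far this reaches. A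
  vector found modulo \<open>det A\<close> can be corrected when \<open>det A \<noteq> 0\<close>,
  because \<open>A\<close> times its adjugate is \<open>det A\<close>. For \<open>det A = 0\<close>
  the matrix brings no nonzero modulus with it, and the obstruction is the class of its column
  module in the Picard group. Hence the nonzero case is unconditional, while the zero case amounts
  to the triviality of that group. For the larger matrices of rank one the trace supplies the
  missing modulus: it is \<open>1\<close>, so some diagonal entry is nonzero.\<close>

no_notation fps_nth (infixl \<open>$\<close> 75)

section \<open>Ideals of a type\<close>

lemma ring_of_sel [simp]:
  "carrier (ring_of TYPE('a::comm_ring_1)) = UNIV"
  "monoid.mult (ring_of TYPE('a)) = (*)"
  "one (ring_of TYPE('a)) = 1"
  "ring.zero (ring_of TYPE('a)) = 0"
  "add (ring_of TYPE('a)) = (+)"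
  by (auto simp: ring_of_type_algebra_def)

lemma cring_ring_of: "cring (ring_of TYPE('a::comm_ring_1))"
  by (rule cring_from_type_algebra)

lemma domain_ring_of: "domain (ring_of TYPE('a::idom))"
  by (intro domain.intro cring_ring_of domain_axioms.intro) auto

lemma ideal_iff:
  "ideal I (ring_of TYPE('a::comm_ring_1)) \<longleftrightarrow>
    0 \<in> I \<and> (\<forall>a\<in>I. \<forall>b\<in>I. a + b \<in> I) \<and> (\<forall>a\<in>I. \<forall>x. x * a \<in> I)"
proof
  assume "ideal I (ring_of TYPE('a))"
  then interpret I: ideal I "ring_of TYPE('a)" .
  show "0 \<in> I \<and> (\<forall>a\<in>I. \<forall>b\<in>I. a + b \<in> I) \<and> (\<forall>a\<in>I. \<forall>x. x * a \<in> I)"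
    using additive_subgroup.zero_closed[OF I.is_additive_subgroup]
      additive_subgroup.a_closed[OF I.is_additive_subgroup] I.I_l_closed
    by simp
next
  interpret R: cring "ring_of TYPE('a)" by (rule cring_ring_of)
  assume I: "0 \<in> I \<and> (\<forall>a\<in>I. \<forall>b\<in>I. a + b \<in> I) \<and> (\<forall>a\<in>I. \<forall>x. x * a \<in> I)"
  show "ideal I (ring_of TYPE('a))"
  proof (rule idealI)
    show "subgroup I (add_monoid (ring_of TYPE('a)))"
    proof (rule group.subgroupI)
      show "group (add_monoid (ring_of TYPE('a)))"
        by (rule R.add.is_group)
      fix a assume a: "a \<in> I"
      have "inv\<^bsub>add_monoid (ring_of TYPE('a))\<^esub> a = - a"
        using R.add.inv_equality[of "- a" a] by (simp add: a_inv_def)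
      moreover have "- 1 * a \<in> I"
        using I a by blast
      ultimately show "inv\<^bsub>add_monoid (ring_of TYPE('a))\<^esub> a \<in> I"
        by simp
    qed (use I in auto)
  qed (use I R.ring_axioms in \<open>auto simp: mult.commute\<close>)
qed

lemma primeideal_iff:
  "primeideal P (ring_of TYPE('a::comm_ring_1)) \<longleftrightarrow>
    ideal P (ring_of TYPE('a)) \<and> 1 \<notin> P \<and> (\<forall>a b. a * b \<in> P \<longrightarrow> a \<in> P \<or> b \<in> P)"
proof
  assume "primeideal P (ring_of TYPE('a))"
  then interpret P: primeideal P "ring_of TYPE('a)" .
  show "ideal P (ring_of TYPE('a)) \<and> 1 \<notin> P \<and> (\<forall>a b. a * b \<in> P \<longrightarrow> a \<in> P \<or> b \<in> P)"
    using P.is_ideal P.one_imp_carrier P.I_notcarr P.I_prime by auto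
next
  assume "ideal P (ring_of TYPE('a)) \<and> 1 \<notin> P \<and> (\<forall>a b. a * b \<in> P \<longrightarrow> a \<in> P \<or> b \<in> P)"
  then show "primeideal P (ring_of TYPE('a))"
    by (intro primeidealI cring_ring_of) auto
qed

lemma ideal_diff:
  assumes "ideal I (ring_of TYPE('a::comm_ring_1))" "a \<in> I" "b \<in> I"
  shows "a - b \<in> I"
proof -
  have "- 1 * b \<in> I"
    using assms unfolding ideal_iff by blast
  then have "a + - 1 * b \<in> I"
    using assms unfolding ideal_iff by blast
  then show ?thesis by simp
qed

lemma ideal_add_iff:
  assumes "ideal I (ring_of TYPE('a::comm_ring_1))" "b \<in> I"
  shows "a + b \<in> I \<longleftrightarrow> a \<in> I"
proof -
  have "a + b - b \<in> I" if "a + b \<in> I"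
    using assms that by (intro ideal_diff)
  then show ?thesis
    using assms unfolding ideal_iff by auto
qed

lemma ideal_mult_right:
  assumes "ideal I (ring_of TYPE('a::comm_ring_1))" "b \<in> I"
  shows "b * x \<in> I" "x * b \<in> I"
  using assms unfolding ideal_iff by (auto simp: mult.commute)

lemma ideal_sum:
  assumes "ideal I (ring_of TYPE('a::comm_ring_1))" "\<And>i. i \<in> S \<Longrightarrow> f i \<in> I"
  shows "sum f S \<in> I"
  using assms(2)
proof (induction S rule: infinite_finite_induct)
qed (use assms(1) in \<open>auto simp: ideal_iff\<close>)

lemma ideal_insert:
  assumes I: "ideal I (ring_of TYPE('a::comm_ring_1))"
  shows "ideal {i + x * a | i x. i \<in> I} (ring_of TYPE('a))" (is "ideal ?J _")
  unfolding ideal_iff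
proof (intro conjI ballI allI)
  show "0 \<in> ?J"
    using I unfolding ideal_iff by (intro CollectI exI[of _ 0]) auto
next
  fix u v assume "u \<in> ?J" "v \<in> ?J"
  then obtain i x j y where "u = i + x * a" "v = j + y * a" "i \<in> I" "j \<in> I" by auto
  moreover from this have "i + j \<in> I" using I unfolding ideal_iff by auto
  moreover have "u + v = (i + j) + (x + y) * a" using calculation by (simp add: algebra_simps)
  ultimately show "u + v \<in> ?J" by blast
next
  fix u z assume "u \<in> ?J"
  then obtain i x where "u = i + x * a" "i \<in> I" by auto
  moreover from this have "z * i \<in> I" using I unfolding ideal_iff by auto
  moreover have "z * u = z * i + (z * x) * a" using calculation by (simp add: algebra_simps)
  ultimately show "z * u \<in> ?J" by blast
qed

text \<open>An ideal \<open>P\<close> maximal among those above \<open>I\<close> that avoid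
  \<open>S\<close> is prime: for \<open>a\<close> and \<open>b\<close> outside \<open>P\<close> both
  \<open>P + a R\<close> and \<open>P + b R\<close> meet \<open>S\<close>, and a product of elements
  of these two ideals lies in \<open>P + a b R\<close>. The set \<open>{1}\<close> gives primes over
  proper ideals; \<open>pi_regular_modulo\<close> uses a larger one.\<close>

lemma exists_prime_disjoint:
  assumes I: "ideal I (ring_of TYPE('a::comm_ring_1))"
    and one: "1 \<in> S" and mult: "\<And>s t. s \<in> S \<Longrightarrow> t \<in> S \<Longrightarrow> s * t \<in> S"
    and disj: "I \<inter> S = {}"
  obtains P where "primeideal P (ring_of TYPE('a))" "I \<subseteq> P" "P \<inter> S = {}"
proof -
  interpret R: cring "ring_of TYPE('a)" by (rule cring_ring_of)
  define F where "F = {J. ideal J (ring_of TYPE('a)) \<and> I \<subseteq> J \<and> J \<inter> S = {}}"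
  have "\<exists>P\<in>F. \<forall>J\<in>F. P \<subseteq> J \<longrightarrow> J = P"
  proof (rule subset_Zorn_nonempty)
    show "F \<noteq> {}"
      using I disj by (auto simp: F_def)
    fix C assume C: "C \<noteq> {}" "subset.chain F C"
    then have "subset.chain {J. ideal J (ring_of TYPE('a))} C"
      unfolding pred_on.chain_def F_def by auto
    then have "ideal (\<Union>C) (ring_of TYPE('a))"
      using R.chain_Union_is_ideal[of C] C(1) by simp
    moreover have "I \<subseteq> \<Union>C" "\<Union>C \<inter> S = {}"
      using C unfolding pred_on.chain_def F_def by blast+
    ultimately show "\<Union>C \<in> F"
      by (simp add: F_def)
  qed
  then obtain P where "P \<in> F" and "\<forall>J\<in>F. P \<subseteq> J \<longrightarrow> J = P"
    by blast
  then have P: "ideal P (ring_of TYPE('a))" "I \<subseteq> P" "P \<inter> S = {}"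
    and max: "\<And>J. ideal J (ring_of TYPE('a)) \<Longrightarrow> P \<subseteq> J \<Longrightarrow> J \<inter> S = {} \<Longrightarrow> J = P"
    unfolding F_def by blast+
  have meet: "\<exists>i x. i \<in> P \<and> i + x * a \<in> S" if "a \<notin> P" for a
  proof (rule ccontr)
    assume H: "\<not> ?thesis"
    let ?J = "{i + x * a | i x. i \<in> P}"
    have "P \<subseteq> ?J"
    proof
      fix i assume "i \<in> P"
      then show "i \<in> ?J" by (intro CollectI exI[of _ i] exI[of _ 0]) auto
    qed
    then have "?J = P"
      using H by (intro max ideal_insert P(1)) auto
    moreover have "a \<in> ?J"
      using P(1) unfolding ideal_iff by (intro CollectI exI[of _ 0] exI[of _ 1]) auto
    ultimately show False using that by simp
  qed
  have "a \<in> P \<or> b \<in> P" if ab: "a * b \<in> P" for a b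
  proof (rule ccontr)
    assume "\<not> ?thesis"
    then obtain i x j y where ij: "i \<in> P" "j \<in> P" "i + x * a \<in> S" "j + y * b \<in> S"
      using meet[of a] meet[of b] by auto
    then have "(i + x * a) * (j + y * b) \<in> S"
      by (intro mult)
    moreover have "(i + x * a) * (j + y * b) = (j + y * b) * i + (x * a) * j + (x * y) * (a * b)"
      by (simp add: algebra_simps)
    moreover have "\<dots> \<in> P"
      using P(1) ij ab unfolding ideal_iff by blast
    ultimately show False using P(3) by auto
  qed
  then have "primeideal P (ring_of TYPE('a))"
    unfolding primeideal_iff using P(1,3) one by blast
  then show ?thesis
    using that P by blast
qed

lemma ideal_span2: "ideal {a * x + b * y | x y. True} (ring_of TYPE('a::comm_ring_1))"
  unfolding ideal_iff
proof (intro conjI ballI allI; clarify?)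
  show "\<exists>x y. 0 = a * x + b * y \<and> True"
    by (intro exI[of _ 0]) auto
next
  fix x y x' y'
  show "\<exists>x'' y''. a * x + b * y + (a * x' + b * y') = a * x'' + b * y'' \<and> True"
    by (intro exI[of _ "x + x'"] exI[of _ "y + y'"]) (simp add: algebra_simps)
next
  fix z x y
  show "\<exists>x' y'. z * (a * x + b * y) = a * x' + b * y' \<and> True"
    by (intro exI[of _ "z * x"] exI[of _ "z * y"]) (simp add: algebra_simps)
qed

text \<open>The passage from local to global: two elements generating a proper ideal lie in a common
  prime. It turns membership arguments at primes into Bezout identities.\<close>

lemma comaximal_if_no_prime:
  fixes a b :: "'a::comm_ring_1"
  assumes "\<And>P. primeideal P (ring_of TYPE('a)) \<Longrightarrow> a \<in> P \<Longrightarrow> b \<in> P \<Longrightarrow> False"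
  shows "\<exists>x y. a * x + b * y = 1"
proof (rule ccontr)
  assume H: "\<not> ?thesis"
  have "{a * x + b * y | x y. True} \<inter> {1} = {}"
    using H by fastforce
  then obtain P where P: "primeideal P (ring_of TYPE('a))" "{a * x + b * y | x y. True} \<subseteq> P"
    by (rule exists_prime_disjoint[OF ideal_span2, rotated 2]) auto
  have "a = a * 1 + b * 0" "b = a * 0 + b * 1" by auto
  then have "a \<in> P" "b \<in> P"
    using P(2) by blast+
  with assms P(1) show False by blast
qed

lemma prime_mult_iff:
  assumes "primeideal P (ring_of TYPE('a::comm_ring_1))"
  shows "a * b \<in> P \<longleftrightarrow> a \<in> P \<or> b \<in> P"
  using assms unfolding primeideal_iff ideal_iff by (metis mult.commute)

lemma prime_power_iff:
  assumes "primeideal P (ring_of TYPE('a::comm_ring_1))"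
  shows "a ^ n \<in> P \<longleftrightarrow> a \<in> P \<and> n > 0"
proof (induction n)
  case 0
  show ?case
    using assms by (simp add: primeideal_iff)
next
  case (Suc n)
  then show ?case
    using assms by (auto simp: prime_mult_iff)
qed


section \<open>Unimodular matrices\<close>

lemma Um_3_iff:
  fixes a b c :: "'a::comm_ring_1"
  shows "vector [a, b, c] \<in> (Um :: ('a ^ 3) set) \<longleftrightarrow> (\<exists>x y z. a * x + b * y + c * z = 1)"
proof
  interpret R: cring "ring_of TYPE('a)" by (rule cring_ring_of)
  \<comment> \<open>The nested form of \<open>?J\<close> lets \<open>ideal_span2\<close> and then
    \<open>ideal_insert\<close> show that it is an ideal.\<close>
  let ?J = "{i + x * c | i x. i \<in> {a * x + b * y | x y. True}}"
  assume "vector [a, b, c] \<in> (Um :: ('a ^ 3) set)"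
  then have "Idl\<^bsub>ring_of TYPE('a)\<^esub> (range (\<lambda>i. (vector [a, b, c] :: 'a ^ 3) $ i)) = UNIV"
    by (simp add: Um_def)
  moreover have "a * 1 + b * 0 + 0 * c \<in> ?J" "a * 0 + b * 1 + 0 * c \<in> ?J"
    "a * 0 + b * 0 + 1 * c \<in> ?J"
    by blast+
  then have "\<forall>i. (vector [a, b, c] :: 'a ^ 3) $ i \<in> ?J"
    unfolding forall_3 vector_3 by simp
  then have "Idl\<^bsub>ring_of TYPE('a)\<^esub> (range (\<lambda>i. (vector [a, b, c] :: 'a ^ 3) $ i)) \<subseteq> ?J"
    by (intro R.genideal_minimal ideal_insert ideal_span2) blast
  ultimately have "1 \<in> ?J" by blast
  then obtain x y z where "1 = a * x + b * y + z * c" by auto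
  then show "\<exists>x y z. a * x + b * y + c * z = 1"
    by (metis mult.commute)
next
  interpret R: cring "ring_of TYPE('a)" by (rule cring_ring_of)
  let ?S = "range (\<lambda>i. (vector [a, b, c] :: 'a ^ 3) $ i)"
  assume "\<exists>x y z. a * x + b * y + c * z = 1"
  then obtain x y z where xyz: "a * x + b * y + c * z = 1" by blast
  have I: "ideal (Idl\<^bsub>ring_of TYPE('a)\<^esub> ?S) (ring_of TYPE('a))"
    by (rule R.genideal_ideal) simp
  have "?S \<subseteq> Idl\<^bsub>ring_of TYPE('a)\<^esub> ?S"
    by (rule R.genideal_self) simp
  then have "\<forall>i. (vector [a, b, c] :: 'a ^ 3) $ i \<in> Idl\<^bsub>ring_of TYPE('a)\<^esub> ?S"
    by blast
  then have "a * x + b * y + c * z \<in> Idl\<^bsub>ring_of TYPE('a)\<^esub> ?S"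
    using I unfolding forall_3 vector_3 by (metis ideal_iff ideal_mult_right(1))
  then show "vector [a, b, c] \<in> (Um :: ('a ^ 3) set)"
    using ideal.one_imp_carrier[OF I] xyz by (simp add: Um_def)
qed

lemma UmM2_iff:
  fixes A :: "'a::comm_ring_1 ^ 2 ^ 2"
  shows "A \<in> UmM2 \<longleftrightarrow>
    (\<exists>x y z w. A$1$1 * x + A$1$2 * y + (A$2$1 * z + A$2$2 * w) = 1)"
proof
  interpret R: cring "ring_of TYPE('a)" by (rule cring_ring_of)
  let ?J = "{i + x * (A$2$2) | i x. i \<in> {i + x * (A$2$1) | i x. i \<in> {A$1$1 * x + A$1$2 * y | x y. True}}}"
  assume "A \<in> UmM2"
  then have "Idl\<^bsub>ring_of TYPE('a)\<^esub> (range (\<lambda>(i, j). A $ i $ j)) = UNIV"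
    by (simp add: UmM2_def)
  moreover have
    "A$1$1 * 1 + A$1$2 * 0 + 0 * (A$2$1) + 0 * (A$2$2) \<in> ?J"
    "A$1$1 * 0 + A$1$2 * 1 + 0 * (A$2$1) + 0 * (A$2$2) \<in> ?J"
    "A$1$1 * 0 + A$1$2 * 0 + 1 * (A$2$1) + 0 * (A$2$2) \<in> ?J"
    "A$1$1 * 0 + A$1$2 * 0 + 0 * (A$2$1) + 1 * (A$2$2) \<in> ?J"
    by blast+
  then have "\<forall>i j. A $ i $ j \<in> ?J"
    unfolding forall_2 by simp
  then have "Idl\<^bsub>ring_of TYPE('a)\<^esub> (range (\<lambda>(i, j). A $ i $ j)) \<subseteq> ?J"
    by (intro R.genideal_minimal ideal_insert ideal_span2 image_subsetI) (simp only: split_paired_all prod.case)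
  ultimately have "1 \<in> ?J" by blast
  then obtain x y z w where "1 = A$1$1 * x + A$1$2 * y + z * A$2$1 + w * A$2$2" by auto
  then show "\<exists>x y z w. A$1$1 * x + A$1$2 * y + (A$2$1 * z + A$2$2 * w) = 1"
    by (intro exI[of _ x] exI[of _ y] exI[of _ z] exI[of _ w]) (simp add: algebra_simps)
next
  interpret R: cring "ring_of TYPE('a)" by (rule cring_ring_of)
  let ?S = "range (\<lambda>(i, j). A $ i $ j)"
  assume "\<exists>x y z w. A$1$1 * x + A$1$2 * y + (A$2$1 * z + A$2$2 * w) = 1"
  then obtain x y z w where xyz: "A$1$1 * x + A$1$2 * y + (A$2$1 * z + A$2$2 * w) = 1" by blast
  have I: "ideal (Idl\<^bsub>ring_of TYPE('a)\<^esub> ?S) (ring_of TYPE('a))"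
    by (rule R.genideal_ideal) simp
  have "?S \<subseteq> Idl\<^bsub>ring_of TYPE('a)\<^esub> ?S"
    by (rule R.genideal_self) simp
  then have "A $ i $ j \<in> Idl\<^bsub>ring_of TYPE('a)\<^esub> ?S" for i j
    by auto
  then have "A$1$1 * x + A$1$2 * y + (A$2$1 * z + A$2$2 * w) \<in> Idl\<^bsub>ring_of TYPE('a)\<^esub> ?S"
    using I by (metis ideal_iff ideal_mult_right(1))
  then show "A \<in> UmM2"
    using ideal.one_imp_carrier[OF I] xyz by (simp add: UmM2_def)
qed

lemma UmM2_prime_iff:
  fixes A :: "'a::comm_ring_1 ^ 2 ^ 2"
  shows "A \<in> UmM2 \<longleftrightarrow> (\<forall>P. primeideal P (ring_of TYPE('a)) \<longrightarrow> (\<exists>i j. A $ i $ j \<notin> P))"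
proof
  assume "A \<in> UmM2"
  then obtain x y z w where xyz: "A$1$1 * x + A$1$2 * y + (A$2$1 * z + A$2$2 * w) = 1"
    unfolding UmM2_iff by blast
  show "\<forall>P. primeideal P (ring_of TYPE('a)) \<longrightarrow> (\<exists>i j. A $ i $ j \<notin> P)"
  proof (intro allI impI, rule ccontr)
    fix P assume P: "primeideal P (ring_of TYPE('a))" and "\<not> (\<exists>i j. A $ i $ j \<notin> P)"
    then have "A$1$1 * x + A$1$2 * y + (A$2$1 * z + A$2$2 * w) \<in> P"
      by (metis ideal_iff ideal_mult_right(1) primeideal_iff)
    with P xyz show False
      by (simp add: primeideal_iff)
  qed
next
  interpret R: cring "ring_of TYPE('a)" by (rule cring_ring_of)
  let ?S = "range (\<lambda>(i, j). A $ i $ j)"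
  have I: "ideal (Idl\<^bsub>ring_of TYPE('a)\<^esub> ?S) (ring_of TYPE('a))"
    by (rule R.genideal_ideal) simp
  have S: "?S \<subseteq> Idl\<^bsub>ring_of TYPE('a)\<^esub> ?S"
    by (rule R.genideal_self) simp
  assume H: "\<forall>P. primeideal P (ring_of TYPE('a)) \<longrightarrow> (\<exists>i j. A $ i $ j \<notin> P)"
  have "1 \<in> Idl\<^bsub>ring_of TYPE('a)\<^esub> ?S"
  proof (rule ccontr)
    assume "1 \<notin> Idl\<^bsub>ring_of TYPE('a)\<^esub> ?S"
    then obtain P where "primeideal P (ring_of TYPE('a))" "Idl\<^bsub>ring_of TYPE('a)\<^esub> ?S \<subseteq> P"
      using exists_prime_disjoint[OF I, of "{1}"] by auto
    with H S show False by auto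
  qed
  then show "A \<in> UmM2"
    using ideal.one_imp_carrier[OF I] by (simp add: UmM2_def)
qed

text \<open>With a zero in the corner, the determinant of an extension is bilinear in its last
  column and its last row. Up to a swap and a sign these are the row \<open>(e, f)\<close> and the
  column \<open>(s, t)\<close>, whence the entries \<open>- f, e\<close> and \<open>t, - s\<close>
  of \<open>?B\<close>.\<close>

lemma simply_extendable_iff:
  fixes A :: "'a::comm_ring_1 ^ 2 ^ 2"
  shows "simply_extendable A \<longleftrightarrow>
    (\<exists>e f s t. e * (A$1$1 * s + A$1$2 * t) + f * (A$2$1 * s + A$2$2 * t) = 1)"
proof
  assume "simply_extendable A"
  then obtain B :: "'a ^ 3 ^ 3" where "det B = 1" "upper_left_block B A" "B $ 3 $ 3 = 0"
    unfolding simply_extendable_def SL3_def by blast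
  then have "B$2$3 * (A$1$1 * (- (B$3$2)) + A$1$2 * B$3$1) +
      (- (B$1$3)) * (A$2$1 * (- (B$3$2)) + A$2$2 * B$3$1) = 1"
    unfolding det_3 upper_left_block_def by (simp add: algebra_simps)
  then show "\<exists>e f s t. e * (A$1$1 * s + A$1$2 * t) + f * (A$2$1 * s + A$2$2 * t) = 1"
    by blast
next
  assume "\<exists>e f s t. e * (A$1$1 * s + A$1$2 * t) + f * (A$2$1 * s + A$2$2 * t) = 1"
  then obtain e f s t where efst: "e * (A$1$1 * s + A$1$2 * t) + f * (A$2$1 * s + A$2$2 * t) = 1"
    by blast
  let ?B = "vector [vector [A$1$1, A$1$2, - f], vector [A$2$1, A$2$2, e], vector [t, - s, 0]] :: 'a ^ 3 ^ 3"
  have "det ?B = 1"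
    using efst unfolding det_3 by (simp add: algebra_simps)
  then show "simply_extendable A"
    unfolding simply_extendable_def SL3_def upper_left_block_def
    by (intro bexI[of _ ?B]) auto
qed

lemma simply_extendable_imp_extendable: "simply_extendable A \<Longrightarrow> extendable A"
  unfolding simply_extendable_def extendable_def by blast

text \<open>If \<open>det A = 0\<close>, the determinant of an extension of \<open>A\<close> does not depend on its \<open>(3, 3)\<close> entry.\<close>

lemma extendable_imp_simply_extendable:
  fixes A :: "'a::comm_ring_1 ^ 2 ^ 2"
  assumes "extendable A" "det A = 0"
  shows "simply_extendable A"
proof -
  obtain B :: "'a ^ 3 ^ 3" where B: "det B = 1" "upper_left_block B A"
    using assms(1) unfolding extendable_def SL3_def by blast
  have "B$2$3 * (A$1$1 * (- (B$3$2)) + A$1$2 * B$3$1) +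
      (- (B$1$3)) * (A$2$1 * (- (B$3$2)) + A$2$2 * B$3$1) = det B - B$3$3 * det A"
    using B(2) unfolding det_3 det_2 upper_left_block_def by (simp add: algebra_simps)
  also have "\<dots> = 1"
    using B(1) assms(2) by simp
  finally show ?thesis
    unfolding simply_extendable_iff by blast
qed


section \<open>Domains of dimension one\<close>

text \<open>Over a domain \<open>{0}\<close> is prime, so a proper inclusion of \<open>P\<close> in
  \<open>Q\<close> would complete a chain of length two.\<close>

lemma nonzero_prime_maximal:
  assumes dim: "krull_dim (ring_of TYPE('a::idom)) = 1"
    and P: "primeideal P (ring_of TYPE('a))" "a \<in> P" "a \<noteq> 0"
    and Q: "primeideal Q (ring_of TYPE('a))" "P \<subseteq> Q"
  shows "P = Q"
proof (rule ccontr)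
  assume "P \<noteq> Q"
  define F where "F i = (if i = 0 then {0} else if i = 1 then P else Q)" for i :: nat
  have "primeideal {0} (ring_of TYPE('a))"
    by (simp add: primeideal_iff ideal_iff)
  moreover have "{0} \<subset> P"
    using P unfolding primeideal_iff ideal_iff by blast
  ultimately have "(\<forall>i\<le>2. primeideal (F i) (ring_of TYPE('a))) \<and> (\<forall>i<2. F i \<subset> F (Suc i))"
    using P Q \<open>P \<noteq> Q\<close> unfolding F_def by (auto simp: less_2_cases_iff)
  then have "enat 2 \<le> krull_dim (ring_of TYPE('a))"
    unfolding krull_dim_def by (intro Sup_upper) blast
  then show False
    by (simp add: dim one_enat_def)
qed

section \<open>Complements modulo a nonzero element\<close>

lemma ideal_multiples: "ideal {r. d dvd r} (ring_of TYPE('a::comm_ring_1))"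
  unfolding ideal_iff by auto

lemma prime_dvd_mem:
  assumes "primeideal P (ring_of TYPE('a::comm_ring_1))" "d \<in> P" "d dvd r"
  shows "r \<in> P"
  using assms unfolding primeideal_iff by (metis dvdE ideal_mult_right(1))

text \<open>
  The powers of \<open>b\<close> times the elements of \<open>1 + b R\<close> form a multiplicative set; a prime avoiding
  it and containing \<open>d \<noteq> 0\<close> would be maximal, yet \<open>b\<close> would not be invertible modulo it.
\<close>

lemma pi_regular_modulo:
  assumes dim: "krull_dim (ring_of TYPE('a::idom)) = 1" and "(d::'a) \<noteq> 0"
  shows "\<exists>n y. d dvd b ^ n * (1 - b * y)"
proof (rule ccontr)
  assume H: "\<not> ?thesis"
  define S where "S = {b ^ n * (1 - b * y) | n y. True}"
  obtain P where P: "primeideal P (ring_of TYPE('a))" "{r. d dvd r} \<subseteq> P" "P \<inter> S = {}"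
  proof (rule exists_prime_disjoint[OF ideal_multiples])
    have "1 = b ^ 0 * (1 - b * 0)" by simp
    then show "1 \<in> S" unfolding S_def by blast
  next
    fix s t assume "s \<in> S" "t \<in> S"
    then obtain n y m z where "s = b ^ n * (1 - b * y)" "t = b ^ m * (1 - b * z)"
      unfolding S_def by blast
    then have "s * t = b ^ (n + m) * (1 - b * (y + z - b * y * z))"
      by (simp only:) (simp add: algebra_simps power_add)
    then show "s * t \<in> S"
      unfolding S_def by blast
  next
    show "{r. d dvd r} \<inter> S = {}"
      using H unfolding S_def by blast
  qed (use that in blast)
  have "b = b ^ 1 * (1 - b * 0)" by simp
  then have "b \<in> S"
    unfolding S_def by blast
  then have "b \<notin> P"
    using P(3) by blast
  have idP: "ideal P (ring_of TYPE('a))"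
    using P(1) unfolding primeideal_iff by blast
  obtain Q where Q: "primeideal Q (ring_of TYPE('a))" "{i + x * b | i x. i \<in> P} \<subseteq> Q"
  proof (rule exists_prime_disjoint[OF ideal_insert[OF idP], of "{1}" b])
    show "{i + x * b | i x. i \<in> P} \<inter> {1} = {}"
    proof (rule ccontr)
      assume "\<not> ?thesis"
      then obtain i x where ix: "i \<in> P" "i + x * b = 1" by auto
      then have "i = b ^ 0 * (1 - b * x)"
        by (simp add: algebra_simps eq_diff_eq)
      then have "i \<in> S"
        unfolding S_def by blast
      then show False using ix P(3) by blast
    qed
  qed (use that in auto)
  have "P \<subseteq> Q"
  proof
    fix i assume "i \<in> P"
    then have "i + 0 * b \<in> Q" using Q(2) by blast
    then show "i \<in> Q" by simp
  qed
  moreover have "0 + 1 * b \<in> Q"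
    using Q(2) idP unfolding ideal_iff by blast
  moreover have "d \<in> P"
    using P(2) by auto
  ultimately show False
    using nonzero_prime_maximal[OF dim P(1) _ \<open>d \<noteq> 0\<close> Q(1)] \<open>b \<notin> P\<close> by simp
qed

text \<open>The complement is \<open>1 - b * y\<close>: as \<open>d\<close> divides
  \<open>b ^ n * (1 - b * y)\<close>, every prime over \<open>d\<close> contains \<open>b\<close> or
  \<open>1 - b * y\<close>, and none contains both because they are comaximal.\<close>

lemma exists_complement:
  assumes dim: "krull_dim (ring_of TYPE('a::idom)) = 1" and "(d::'a) \<noteq> 0"
  obtains e where "\<And>P. primeideal P (ring_of TYPE('a)) \<Longrightarrow> d \<in> P \<Longrightarrow> e \<in> P \<longleftrightarrow> b \<notin> P"
proof -
  obtain n y where dvd: "d dvd b ^ n * (1 - b * y)"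
    using pi_regular_modulo[OF assms] by blast
  have "1 - b * y \<in> P \<longleftrightarrow> b \<notin> P" if P: "primeideal P (ring_of TYPE('a))" "d \<in> P" for P
  proof -
    have "1 - b * y \<in> P \<or> b \<in> P"
      using prime_dvd_mem[OF P dvd] P by (auto simp: prime_mult_iff prime_power_iff)
    moreover have "1 \<in> P" if "b \<in> P" "1 - b * y \<in> P"
      using ideal_add_iff[of P "b * y" "1 - b * y"] ideal_mult_right[of P b y] that P
      by (auto simp: primeideal_iff)
    ultimately show ?thesis
      using P by (auto simp: primeideal_iff)
  qed
  then show ?thesis
    using that by blast
qed

text \<open>This is stable range one for \<open>R / w R\<close>. With \<open>x\<close> a complement
  of \<open>b\<close>, a prime over \<open>w\<close> that contains \<open>b\<close> contains neither
  \<open>c\<close> nor \<open>x\<close>; one that does not contain \<open>b\<close> contains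
  \<open>c * x\<close>. Either way \<open>b + c * x\<close> stays outside.\<close>

lemma stable_range_modulo:
  assumes dim: "krull_dim (ring_of TYPE('a::idom)) = 1" and "(w::'a) \<noteq> 0"
    and cmx: "\<And>P. primeideal P (ring_of TYPE('a)) \<Longrightarrow> w \<in> P \<Longrightarrow> b \<in> P \<Longrightarrow> c \<in> P \<Longrightarrow> False"
  obtains x y z where "w * y + (b + c * x) * z = 1"
proof -
  obtain e where e: "\<And>P. primeideal P (ring_of TYPE('a)) \<Longrightarrow> w \<in> P \<Longrightarrow> e \<in> P \<longleftrightarrow> b \<notin> P"
    using exists_complement[OF dim \<open>w \<noteq> 0\<close>] by blast
  have False if P: "primeideal P (ring_of TYPE('a))" and "w \<in> P" "b + c * e \<in> P" for P
  proof -
    have id: "ideal P (ring_of TYPE('a))"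
      using P unfolding primeideal_iff by blast
    show False
    proof (cases "b \<in> P")
      case True
      then have "c * e \<in> P"
        using that ideal_add_iff[OF id True, of "c * e"] by (simp add: add.commute)
      then show False
        using cmx e P that True by (auto simp: prime_mult_iff)
    next
      case False
      then have "c * e \<in> P"
        using e P that by (auto simp: prime_mult_iff)
      then show False
        using that ideal_add_iff[OF id, of "c * e" b] False by simp
    qed
  qed
  then show ?thesis
    using that comaximal_if_no_prime[of w "b + c * e"] by blast
qed


section \<open>Matrices with nonzero determinant\<close>

text \<open>Lifting a unimodular pair from \<open>R / d R\<close> is stable range with
  \<open>v\<close> as modulus, so that only \<open>w\<close> has to move. The modulus must be
  nonzero; if \<open>v = 0\<close>, it is first replaced by \<open>d\<close>.\<close>

lemma comaximal_if_comaximal_modulo: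
  assumes dim: "krull_dim (ring_of TYPE('a::idom)) = 1" and "(d::'a) \<noteq> 0"
    and cmx: "\<And>P. primeideal P (ring_of TYPE('a)) \<Longrightarrow> v \<in> P \<Longrightarrow> w \<in> P \<Longrightarrow> d \<in> P \<Longrightarrow> False"
  obtains x y e f where "e * (v + d * x) + f * (w + d * y) = 1"
proof (cases "v = 0")
  case False
  obtain y e f where "v * e + (w + d * y) * f = 1"
    by (rule stable_range_modulo[OF dim False cmx])
  then have "e * (v + d * 0) + f * (w + d * y) = 1"
    by (simp add: algebra_simps)
  then show ?thesis
    by (rule that)
next
  case True
  have *: False if "primeideal P (ring_of TYPE('a))" "d \<in> P" "w \<in> P" "d \<in> P" for P
    using cmx[OF that(1)] that True by (simp add: primeideal_iff ideal_iff)
  obtain y e f where "d * e + (w + d * y) * f = 1"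
    by (rule stable_range_modulo[OF dim \<open>d \<noteq> 0\<close> *])
  then have "e * (v + d * 1) + f * (w + d * y) = 1"
    using True by (simp add: algebra_simps)
  then show ?thesis
    by (rule that)
qed

text \<open>
  The vector \<open>(1, z)\<close>, with \<open>z\<close> a unit exactly at the primes over \<open>det A\<close> where the first column
  vanishes, has an image that is unimodular modulo \<open>det A\<close>. Adding a multiple of the adjugate to
  the vector changes the image by an arbitrary element of \<open>det A R\<^sup>2\<close>.
\<close>

lemma det_nonzero_imp_simply_extendable:
  fixes A :: "'a::idom ^ 2 ^ 2"
  assumes dim: "krull_dim (ring_of TYPE('a)) = 1" and A: "A \<in> UmM2" and det: "det A \<noteq> 0"
  shows "simply_extendable A"
proof -
  define a b c d D where "a = A$1$1" and "b = A$1$2" and "c = A$2$1" and "d = A$2$2"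
    and "D = det A"
  note abcd = this
  have D: "D = a * d - b * c"
    by (simp add: abcd det_2)
  have "D \<noteq> 0"
    using det by (simp add: abcd)
  obtain e f where e: "\<And>P. primeideal P (ring_of TYPE('a)) \<Longrightarrow> D \<in> P \<Longrightarrow> e \<in> P \<longleftrightarrow> a \<notin> P"
    and f: "\<And>P. primeideal P (ring_of TYPE('a)) \<Longrightarrow> D \<in> P \<Longrightarrow> f \<in> P \<longleftrightarrow> c \<notin> P"
    using exists_complement[OF dim \<open>D \<noteq> 0\<close>] by metis
  define z where "z = e * f"
  have cmx: False if P: "primeideal P (ring_of TYPE('a))" and "a + b * z \<in> P" "c + d * z \<in> P" "D \<in> P" for P
  proof -
    have id: "ideal P (ring_of TYPE('a))"
      using P unfolding primeideal_iff by blast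
    show False
    proof (cases "a \<in> P \<and> c \<in> P")
      case True
      then have "b * z \<in> P" "d * z \<in> P"
        using that ideal_add_iff[OF id, of a "b * z"] ideal_add_iff[OF id, of c "d * z"]
        by (simp_all add: add.commute)
      moreover have "z \<notin> P"
        using e f True P that by (simp add: z_def prime_mult_iff)
      ultimately have "a \<in> P" "b \<in> P" "c \<in> P" "d \<in> P"
        using P True by (auto simp: prime_mult_iff)
      then have "\<forall>i j. A $ i $ j \<in> P"
        by (simp add: abcd forall_2)
      then show False
        using A P unfolding UmM2_prime_iff by blast
    next
      case False
      then have "z \<in> P"
        using e f P that by (simp add: z_def prime_mult_iff)
      then have "a \<in> P" "c \<in> P"
        using that ideal_add_iff[OF id, of "b * z" a] ideal_add_iff[OF id, of "d * z" c]
          ideal_mult_right[OF id] by simp_all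
      then show False
        using False by blast
    qed
  qed
  obtain x y u v where "u * (a + b * z + D * x) + v * (c + d * z + D * y) = 1"
    by (rule comaximal_if_comaximal_modulo[OF dim \<open>D \<noteq> 0\<close> cmx])
  \<comment> \<open>The new coordinates are those of \<open>(1, z)\<close> plus the adjugate of
    \<open>A\<close> applied to \<open>(x, y)\<close>.\<close>
  moreover have "a + b * z + D * x = a * (1 + (d * x - b * y)) + b * (z + (a * y - c * x))"
    "c + d * z + D * y = c * (1 + (d * x - b * y)) + d * (z + (a * y - c * x))"
    by (simp_all add: D algebra_simps)
  ultimately show ?thesis
    unfolding simply_extendable_iff abcd by metis
qed

text \<open>A triangular matrix of determinant zero has a zero on the diagonal; the other entries
  then fill a single row or column, which is itself unimodular.\<close>

lemma triangular_imp_simply_extendable: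
  fixes A :: "'a::idom ^ 2 ^ 2"
  assumes dim: "krull_dim (ring_of TYPE('a)) = 1" and A: "A \<in> UmM2"
    and tri: "A $ 2 $ 1 = 0 \<or> A $ 1 $ 2 = 0"
  shows "simply_extendable A"
proof (cases "det A = 0")
  case True
  then have "A$1$1 = 0 \<or> A$2$2 = 0"
    using tri by (auto simp: det_2)
  moreover obtain x y z w where
    xyzw: "A$1$1 * x + A$1$2 * y + (A$2$1 * z + A$2$2 * w) = 1"
    using A unfolding UmM2_iff by blast
  have "y * (A$1$1 * 0 + A$1$2 * 1) + w * (A$2$1 * 0 + A$2$2 * 1) = 1"
    if "A$1$1 = 0" "A$2$1 = 0"
    using that xyzw by (simp add: algebra_simps)
  moreover have "1 * (A$1$1 * x + A$1$2 * y) + 0 * (A$2$1 * x + A$2$2 * y) = 1"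
    if "A$2$2 = 0" "A$2$1 = 0"
    using that xyzw by (simp add: algebra_simps)
  moreover have "0 * (A$1$1 * z + A$1$2 * w) + 1 * (A$2$1 * z + A$2$2 * w) = 1"
    if "A$1$1 = 0" "A$1$2 = 0"
    using that xyzw by (simp add: algebra_simps)
  moreover have "x * (A$1$1 * 1 + A$1$2 * 0) + z * (A$2$1 * 1 + A$2$2 * 0) = 1"
    if "A$2$2 = 0" "A$1$2 = 0"
    using that xyzw by (simp add: algebra_simps)
  ultimately show ?thesis
    unfolding simply_extendable_iff using tri by blast
next
  case False
  then show ?thesis
    using det_nonzero_imp_simply_extendable[OF dim A] by blast
qed

lemma SE2_tri_ring_if_dim_1:
  "krull_dim (ring_of TYPE('a::idom)) = 1 \<Longrightarrow> SE2_tri_ring TYPE('a)"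
  unfolding SE2_tri_ring_def using triangular_imp_simply_extendable by blast

text \<open>
  Expanding the first equation of a \<open>V\<^sub>2\<close> ring with the second one gives \<open>a x + b y + c w = 1\<close>, which
  a simple extension of the triangular matrix with rows \<open>(a, b)\<close> and \<open>(0, c)\<close> solves.
\<close>

lemma V2_ring_if_SE2_tri_ring:
  assumes "SE2_tri_ring TYPE('a::comm_ring_1)"
  shows "V2_ring TYPE('a)"
  unfolding V2_ring_def
proof (intro allI impI)
  fix a b c :: 'a
  assume "vector [a, b, c] \<in> (Um :: ('a ^ 3) set)"
  then obtain x y z where xyz: "a * x + b * y + c * z = 1"
    unfolding Um_3_iff by blast
  let ?A = "vector [vector [a, b], vector [0, c]] :: 'a ^ 2 ^ 2"
  have "a * x + b * y + (0 * 0 + c * z) = 1"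
    using xyz by (simp add: algebra_simps)
  then have "?A \<in> UmM2"
    unfolding UmM2_iff vector_2 by blast
  then have "simply_extendable ?A"
    using assms unfolding SE2_tri_ring_def by simp
  then obtain e f s t where "e * (a * s + b * t) + f * (0 * s + c * t) = 1"
    unfolding simply_extendable_iff vector_2 by blast
  then have efst: "b * e * t = 1 - a * e * s - c * f * t"
    by (simp add: algebra_simps eq_diff_eq)
  have "(1 - a * (e * s)) * (1 - c * (f * t)) = (e * t) * (b + a * c * (f * s))"
    using efst by (simp add: algebra_simps)
  \<comment> \<open>The witnesses are the entries of the outer product of \<open>(e, f)\<close> and
    \<open>(s, t)\<close>, so \<open>x * w = y * z\<close>.\<close>
  then show "\<exists>x y z w. (1 - a * x) * (1 - c * w) = y * (b + a * c * z) \<and> x * w = y * z"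
    by (intro exI[of _ "e * s"] exI[of _ "e * t"] exI[of _ "f * s"] exI[of _ "f * t"])
      (simp add: algebra_simps)
qed

text \<open>
  For a matrix \<open>X\<close> of rank one, \<open>det (A - det A X) = det A (1 - tr (adj A X))\<close>; a simple extension
  of \<open>A\<close> provides an \<open>X\<close> with \<open>tr (adj A X) = 1\<close>.
\<close>

lemma Z2_ring_if_simply_extendable:
  assumes "\<And>A :: 'a::comm_ring_1 ^ 2 ^ 2. A \<in> UmM2 \<Longrightarrow> det A \<noteq> 0 \<Longrightarrow> simply_extendable A"
  shows "Z2_ring TYPE('a)"
  unfolding Z2_ring_def
proof
  fix A :: "'a ^ 2 ^ 2" assume A: "A \<in> UmM2"
  show "\<exists>B\<in>UmM2. det B = 0 \<and> (\<forall>i j. det A dvd (A - B) $ i $ j)"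
  proof (cases "det A = 0")
    case True
    then show ?thesis
      using A by (intro bexI[of _ A]) auto
  next
    case False
    then obtain e f s t where
      efst: "e * (A$1$1 * s + A$1$2 * t) + f * (A$2$1 * s + A$2$2 * t) = 1"
      using assms A unfolding simply_extendable_iff by blast
    define a b c d D where "a = A$1$1" and "b = A$1$2" and "c = A$2$1" and "d = A$2$2"
      and "D = det A"
    note abcd = this
    have D: "D = a * d - b * c"
      by (simp add: abcd det_2)
    have efst': "e * (a * s + b * t) + f * (c * s + d * t) = 1"
      using efst by (simp add: abcd)
    \<comment> \<open>The matrix subtracted from \<open>A\<close> is \<open>D\<close> times the
      adjugate of the column \<open>(s, t)\<close> times the row \<open>(e, f)\<close>.\<close>
    define B where "B = (vector [vector [a - D * (f * t), b + D * (f * s)],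
      vector [c + D * (e * t), d - D * (e * s)]] :: 'a ^ 2 ^ 2)"
    have B: "B$1$1 = a - D * (f * t)" "B$1$2 = b + D * (f * s)"
      "B$2$1 = c + D * (e * t)" "B$2$2 = d - D * (e * s)"
      by (simp_all add: B_def)
    have "det B = D * (1 - (e * (a * s + b * t) + f * (c * s + d * t)))"
      unfolding det_2 B by (simp add: D algebra_simps)
    then have "det B = 0"
      by (simp add: efst')
    moreover have "\<forall>i j. D dvd (A - B) $ i $ j"
      by (simp add: forall_2 B flip: abcd)
    moreover have "B \<in> UmM2"
      unfolding UmM2_prime_iff
    proof (intro allI impI, rule ccontr)
      fix P assume P: "primeideal P (ring_of TYPE('a))" and "\<not> (\<exists>i j. B $ i $ j \<notin> P)"
      then have BP: "B $ i $ j \<in> P" for i j by blast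
      have id: "ideal P (ring_of TYPE('a))"
        using P unfolding primeideal_iff by blast
      \<comment> \<open>If \<open>B\<close> vanishes modulo \<open>P\<close>, then \<open>A\<close>
        is there a multiple of a matrix of determinant zero, so \<open>D = det A\<close> vanishes as
        well. The identity makes this explicit.\<close>
      have "D = d * B$1$1 + (D * f * t) * B$2$2 + ((D * f * s) * B$2$1 - c * B$1$2)"
        unfolding B by (simp add: D algebra_simps)
      then have "D \<in> P"
        using BP by (metis ideal_diff[OF id] ideal_iff id)
      have "A $ i $ j \<in> P" for i j
      proof -
        have "D dvd (A - B) $ i $ j"
          using \<open>\<forall>i j. D dvd (A - B) $ i $ j\<close> by blast
        then have "A $ i $ j - B $ i $ j \<in> P"
          using prime_dvd_mem[OF P \<open>D \<in> P\<close>] by simp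
        then show ?thesis
          using ideal_add_iff[OF id BP, of "A $ i $ j - B $ i $ j" i j] by simp
      qed
      then show False
        using A P unfolding UmM2_prime_iff by blast
    qed
    ultimately show ?thesis
      unfolding abcd by blast
  qed
qed


section \<open>Rank one matrices of trace one\<close>

text \<open>The form given by the matrix \<open>E\<close>. Sizes are numbers and not index types
  because \<open>n\<close> is only obtained inside proofs, as a number of generators.\<close>

definition bilin :: "nat \<Rightarrow> (nat \<Rightarrow> nat \<Rightarrow> 'a::comm_ring_1) \<Rightarrow> (nat \<Rightarrow> 'a) \<Rightarrow> (nat \<Rightarrow> 'a) \<Rightarrow> 'a"
  where "bilin n E t z = (\<Sum>i<n. t i * (\<Sum>j<n. z j * E i j))"

definition unit_vec :: "nat \<Rightarrow> nat \<Rightarrow> 'a::comm_ring_1"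
  where "unit_vec k i = (if i = k then 1 else 0)"

lemma bilin_combine:
  "bilin n E (\<lambda>i. a * t i + b * t' i) z = a * bilin n E t z + b * bilin n E t' z"
  "bilin n E t (\<lambda>i. a * z i + b * z' i) = a * bilin n E t z + b * bilin n E t z'"
  by (simp_all add: bilin_def sum.distrib sum_distrib_left algebra_simps)

lemma bilin_unit_vec:
  "i < n \<Longrightarrow> j < n \<Longrightarrow> bilin n E (unit_vec i) (unit_vec j) = E i j"
  by (simp add: bilin_def unit_vec_def if_distrib[of "\<lambda>x. x * _"] sum.delta cong: if_cong)

text \<open>Minors of size two are multilinear, so they stay zero when columns and then rows are
  combined. The vector \<open>r z\<close> is the column of \<open>E\<close> combined with
  coefficients \<open>z\<close>.\<close>

lemma bilin_rank_one:
  assumes rank: "\<And>i j k l. i < n \<Longrightarrow> j < n \<Longrightarrow> k < n \<Longrightarrow> l < n \<Longrightarrow> E i j * E k l = E i l * E k j"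
  shows "bilin n E t z * bilin n E t' z' = bilin n E t z' * bilin n E t' z"
proof -
  define r where "r z i = (\<Sum>j<n. z j * E i j)" for z i
  have r: "r z i * r z' k = r z' i * r z k" if "i < n" "k < n" for z z' i k
  proof -
    have "r z i * r z' k = (\<Sum>j<n. \<Sum>l<n. (z j * z' l) * (E i j * E k l))"
      unfolding r_def sum_product by (intro sum.cong refl) (simp add: ac_simps)
    also have "\<dots> = (\<Sum>j<n. \<Sum>l<n. (z j * z' l) * (E i l * E k j))"
      using rank that by (intro sum.cong refl) simp
    also have "\<dots> = (\<Sum>l<n. \<Sum>j<n. (z j * z' l) * (E i l * E k j))"
      by (rule sum.swap)
    also have "\<dots> = r z' i * r z k"
      unfolding r_def sum_product by (intro sum.cong refl) (simp add: ac_simps)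
    finally show ?thesis .
  qed
  have "bilin n E t z * bilin n E t' z' = (\<Sum>i<n. \<Sum>k<n. (t i * t' k) * (r z i * r z' k))"
    unfolding bilin_def r_def[symmetric] sum_product by (intro sum.cong refl) (simp add: ac_simps)
  also have "\<dots> = (\<Sum>i<n. \<Sum>k<n. (t i * t' k) * (r z' i * r z k))"
    using r by (intro sum.cong refl) simp
  also have "\<dots> = bilin n E t z' * bilin n E t' z"
    unfolding bilin_def r_def[symmetric] sum_product by (intro sum.cong refl) (simp add: ac_simps)
  finally show ?thesis .
qed

text \<open>One diagonal entry is added at a time. With \<open>b\<close> the value so far and
  \<open>e\<close> its complement, the new vectors give \<open>b ^ 3\<close> and
  \<open>e ^ 2 * E k k\<close> plus cross terms divisible by \<open>b * e\<close>: at a prime over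
  \<open>d\<close> the first term decides if \<open>b\<close> is a unit there, the second if
  \<open>b\<close> vanishes.\<close>

lemma bilin_unit_at_primes:
  fixes E :: "nat \<Rightarrow> nat \<Rightarrow> 'a::idom"
  assumes dim: "krull_dim (ring_of TYPE('a)) = 1" and "d \<noteq> 0" and "k \<le> n"
  shows "\<exists>t z. \<forall>P. primeideal P (ring_of TYPE('a)) \<longrightarrow> d \<in> P \<longrightarrow> (\<exists>i<k. E i i \<notin> P) \<longrightarrow>
    bilin n E t z \<notin> P"
  using \<open>k \<le> n\<close>
proof (induction k)
  case 0
  show ?case by auto
next
  case (Suc k)
  then obtain t z where tz: "\<And>P. primeideal P (ring_of TYPE('a)) \<Longrightarrow> d \<in> P \<Longrightarrow>
      \<exists>i<k. E i i \<notin> P \<Longrightarrow> bilin n E t z \<notin> P"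
    by (metis Suc_leD)
  define b where "b = bilin n E t z"
  obtain e where e: "\<And>P. primeideal P (ring_of TYPE('a)) \<Longrightarrow> d \<in> P \<Longrightarrow> e \<in> P \<longleftrightarrow> b \<notin> P"
    using exists_complement[OF dim \<open>d \<noteq> 0\<close>, of b] by blast
  let ?t = "\<lambda>i. b * t i + e * unit_vec k i"
  let ?z = "\<lambda>i. b * z i + e * unit_vec k i"
  define c where "c = bilin n E t (unit_vec k) + bilin n E (unit_vec k) z"
  have eq: "bilin n E ?t ?z = b * b * b + b * e * c + e * e * E k k"
    unfolding bilin_combine using Suc.prems
    by (simp add: bilin_unit_vec c_def algebra_simps flip: b_def)
  have "bilin n E ?t ?z \<notin> P"
    if P: "primeideal P (ring_of TYPE('a))" "d \<in> P" and ex: "\<exists>i<Suc k. E i i \<notin> P" for P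
  proof -
    have id: "ideal P (ring_of TYPE('a))"
      using P(1) unfolding primeideal_iff by blast
    show ?thesis
    proof (cases "b \<in> P")
      case True
      then have "E k k \<notin> P" "e \<notin> P"
        using tz[OF P] e[OF P] ex by (auto simp: b_def less_Suc_eq)
      then have "e * e * E k k \<notin> P"
        using P(1) by (simp add: prime_mult_iff)
      moreover have "b * (b * b + e * c) \<in> P"
        using True P(1) by (simp add: prime_mult_iff)
      ultimately show ?thesis
        using ideal_add_iff[OF id, of "b * (b * b + e * c)" "e * e * E k k"]
        by (simp add: eq algebra_simps)
    next
      case False
      then have "e * (b * c + e * E k k) \<in> P"
        using e[OF P] P(1) by (simp add: prime_mult_iff)
      moreover have "b * b * b \<notin> P"
        using False P(1) by (simp add: prime_mult_iff)
      ultimately show ?thesis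
        using ideal_add_iff[OF id, of "e * (b * c + e * E k k)" "b * b * b"]
        by (simp add: eq algebra_simps)
    qed
  qed
  then show ?case by blast
qed

text \<open>
  Over the zero-dimensional ring modulo a nonzero diagonal entry \<open>d\<close> the form represents a unit,
  so \<open>1\<close> is a combination of two values of the form, and the corresponding \<open>2 \<times> 2\<close> matrix of values
  is unimodular of determinant zero.
\<close>

lemma bilin_represents_one:
  fixes E :: "nat \<Rightarrow> nat \<Rightarrow> 'a::idom"
  assumes dim: "krull_dim (ring_of TYPE('a)) = 1" and Pi2: "Pi2_ring TYPE('a)"
    and rank: "\<And>i j k l. i < n \<Longrightarrow> j < n \<Longrightarrow> k < n \<Longrightarrow> l < n \<Longrightarrow> E i j * E k l = E i l * E k j"
    and trace: "(\<Sum>i<n. E i i) = 1"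
  obtains t z where "bilin n E t z = 1"
proof -
  obtain m where m: "m < n" "E m m \<noteq> 0"
    using trace sum.neutral[of "{..<n}" "\<lambda>i. E i i"] by fastforce
  define d where "d = E m m"
  have "d \<noteq> 0"
    using m by (simp add: d_def)
  obtain t z where tz: "\<forall>P. primeideal P (ring_of TYPE('a)) \<longrightarrow> d \<in> P \<longrightarrow>
      (\<exists>i<n. E i i \<notin> P) \<longrightarrow> bilin n E t z \<notin> P"
    using bilin_unit_at_primes[OF dim \<open>d \<noteq> 0\<close> order_refl, of n E] by (elim exE)
  have "False" if P: "primeideal P (ring_of TYPE('a))" "bilin n E t z \<in> P" "d \<in> P" for P
  proof -
    have "(\<Sum>i<n. E i i) \<in> P"
      using tz[rule_format, OF P(1,3)] P by (intro ideal_sum) (auto simp: primeideal_iff)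
    then show False
      using P(1) by (simp add: trace primeideal_iff)
  qed
  then obtain x y where xy: "bilin n E t z * x + d * y = 1"
    using comaximal_if_no_prime[of "bilin n E t z" d] by blast
  let ?u = "unit_vec m :: nat \<Rightarrow> 'a"
  let ?A = "vector [vector [bilin n E t z, bilin n E t ?u], vector [bilin n E ?u z, d]] :: 'a ^ 2 ^ 2"
  have d: "d = bilin n E ?u ?u"
    using m by (simp add: bilin_unit_vec d_def)
  have "bilin n E t z * x + bilin n E t ?u * 0 + (bilin n E ?u z * 0 + d * y) = 1"
    using xy by simp
  then have "?A \<in> UmM2"
    unfolding UmM2_iff vector_2 by blast
  moreover have "det ?A = 0"
    using bilin_rank_one[where t = t and z = z and t' = ?u and z' = ?u, OF rank] by (simp add: det_2 d)
  ultimately have "simply_extendable ?A"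
    using Pi2 extendable_imp_simply_extendable unfolding Pi2_ring_def by blast
  then obtain e f r s where
    "e * (bilin n E t z * r + bilin n E t ?u * s) + f * (bilin n E ?u z * r + d * s) = 1"
    unfolding simply_extendable_iff vector_2 by blast
  \<comment> \<open>Bilinearity absorbs the coefficients of the extension into the vectors, so the
    value \<open>1\<close> of \<open>?A\<close> is a value of \<open>E\<close>.\<close>
  then have "bilin n E (\<lambda>i. e * t i + f * ?u i) (\<lambda>i. r * z i + s * ?u i) = 1"
    unfolding bilin_combine d by (simp add: algebra_simps)
  then show ?thesis
    by (rule that)
qed


section \<open>Principal ideal domains and Dedekind domains\<close>

text \<open>
  If \<open>g (r, s)\<close> is the first row of \<open>A\<close>, with \<open>g\<close> a generator of the ideal of its entries, then the
  second row is also a multiple of \<open>(r, s)\<close>.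
\<close>

lemma Pi2_ring_if_principal_domain:
  assumes "principal_domain (ring_of TYPE('a::idom))"
  shows "Pi2_ring TYPE('a)"
  unfolding Pi2_ring_def
proof (intro ballI impI)
  fix A :: "'a ^ 2 ^ 2" assume A: "A \<in> UmM2" and det: "det A = 0"
  define a b c d where "a = A$1$1" and "b = A$1$2" and "c = A$2$1" and "d = A$2$2"
  note abcd = this
  obtain x1 x2 x3 x4 where x1234: "a * x1 + b * x2 + (c * x3 + d * x4) = 1"
    using A unfolding UmM2_iff abcd by blast
  have "\<exists>g. {a * x + b * y | x y. True} = PIdl\<^bsub>ring_of TYPE('a)\<^esub> g"
    using principal_domain.exists_gen[OF assms ideal_span2] by blast
  then obtain g where g: "{a * x + b * y | x y. True} = {x * g | x. True}"
    unfolding cgenideal_def by auto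
  have "a * 1 + b * 0 \<in> {x * g | x. True}" "a * 0 + b * 1 \<in> {x * g | x. True}"
    unfolding g[symmetric] by blast+
  then obtain r s where r: "a = r * g" and s: "b = s * g"
    by auto
  have "1 * g \<in> {a * x + b * y | x y. True}"
    unfolding g by blast
  then obtain x y where xy: "g = a * x + b * y"
    by auto
  have "\<exists>e f s t. e * (a * s + b * t) + f * (c * s + d * t) = 1"
  proof (cases "g = 0")
    case True
    then have "0 * (a * x3 + b * x4) + 1 * (c * x3 + d * x4) = 1"
      using x1234 r s by simp
    then show ?thesis by blast
  next
    case False
    have "g * (r * x + s * y) = g * 1"
      using xy by (simp add: r s algebra_simps)
    then have rs: "r * x + s * y = 1"
      using False mult_left_cancel by blast
    have "g * (r * d) = g * (s * c)"
      using det by (simp add: det_2 r s algebra_simps flip: abcd)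
    then have cd: "r * d = s * c"
      using False mult_left_cancel by blast
    \<comment> \<open>Since \<open>(x, y)\<close> pairs to \<open>1\<close> with
      \<open>(r, s)\<close>, the factor of the second row is its pairing with
      \<open>(x, y)\<close>.\<close>
    define q where "q = c * x + d * y"
    have "c = (r * x + s * y) * c" "d = (r * x + s * y) * d"
      by (simp_all add: rs)
    moreover have "(r * x + s * y) * c = r * q + (s * c - r * d) * y"
      "(r * x + s * y) * d = s * q - (s * c - r * d) * x"
      by (simp_all add: q_def algebra_simps)
    ultimately have q: "c = r * q" "d = s * q"
      by (simp_all add: cd)
    have "(r * x1 + s * x2) * (a * x + b * y) + (r * x3 + s * x4) * (c * x + d * y) =
        (r * x1 + s * x2) * g + (r * x3 + s * x4) * q"
      by (simp add: xy q_def)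
    also have "\<dots> = 1"
      using x1234 by (simp add: r s q algebra_simps)
    finally show ?thesis by blast
  qed
  then show "extendable A"
    by (intro simply_extendable_imp_extendable) (simp add: simply_extendable_iff abcd)
qed

text \<open>The fraction \<open>b / d\<close> maps \<open>J\<close> into itself, so its powers times
  \<open>a\<close> stay in \<open>R\<close>; \<open>u n\<close> is the \<open>n\<close>-th of them.
  The ideals spanned by the first \<open>n\<close> stabilise, and cancelling \<open>a\<close> turns
  the resulting relation into a monic equation for \<open>b / d\<close>.\<close>

lemma dvd_if_stabilizes_ideal:
  fixes a b d :: "'a::idom"
  assumes noeth: "noetherian_ring (ring_of TYPE('a))" and closed: "integrally_closed TYPE('a)"
    and "a \<in> J" "a \<noteq> 0" "d \<noteq> 0"
    and stab: "\<And>j. j \<in> J \<Longrightarrow> \<exists>j'\<in>J. b * j = d * j'"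
  shows "d dvd b"
proof -
  interpret R: noetherian_ring "ring_of TYPE('a)" by (rule noeth)
  obtain s where s: "\<And>j. j \<in> J \<Longrightarrow> s j \<in> J \<and> b * j = d * s j"
    using stab by metis
  define u where "u n = (s ^^ n) a" for n
  have u: "u n \<in> J" "b * u n = d * u (Suc n)" for n
  proof -
    show "u n \<in> J"
      by (induction n) (use s \<open>a \<in> J\<close> in \<open>auto simp: u_def\<close>)
    then show "b * u n = d * u (Suc n)"
      using s by (simp add: u_def)
  qed
  define I where "I n = {(\<Sum>i<n. r i * u i) | r. True}" for n :: nat
  have ideal: "ideal (I n) (ring_of TYPE('a))" for n
    unfolding ideal_iff
  proof (intro conjI ballI allI)
    show "0 \<in> I n"
      unfolding I_def by (intro CollectI exI[of _ "\<lambda>_. 0"]) simp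
  next
    fix x y assume "x \<in> I n" "y \<in> I n"
    then obtain r r' where "x = (\<Sum>i<n. r i * u i)" "y = (\<Sum>i<n. r' i * u i)"
      unfolding I_def by blast
    then have "x + y = (\<Sum>i<n. (r i + r' i) * u i)"
      by (simp add: sum.distrib algebra_simps)
    then show "x + y \<in> I n"
      unfolding I_def by (intro CollectI exI[of _ "\<lambda>i. r i + r' i"]) simp
  next
    fix x z assume "x \<in> I n"
    then obtain r where "x = (\<Sum>i<n. r i * u i)"
      unfolding I_def by blast
    then have "z * x = (\<Sum>i<n. (z * r i) * u i)"
      by (simp add: sum_distrib_left algebra_simps)
    then show "z * x \<in> I n"
      unfolding I_def by (intro CollectI exI[of _ "\<lambda>i. z * r i"]) simp
  qed
  have "I n \<subseteq> I (Suc n)" for n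
  proof
    fix x assume "x \<in> I n"
    then obtain r where "x = (\<Sum>i<n. r i * u i)"
      unfolding I_def by blast
    then have "x = (\<Sum>i<Suc n. (r(n := 0)) i * u i)"
      by simp
    then show "x \<in> I (Suc n)"
      unfolding I_def by blast
  qed
  then have mono: "m \<le> n \<Longrightarrow> I m \<subseteq> I n" for m n
    by (rule lift_Suc_mono_le)
  have "subset.chain {I. ideal I (ring_of TYPE('a))} (range I)"
    unfolding subset_chain_def
  proof (intro conjI ballI)
    show "range I \<subseteq> {I. ideal I (ring_of TYPE('a))}"
      using ideal by auto
    fix A B assume "A \<in> range I" "B \<in> range I"
    then obtain m n where "A = I m" "B = I n" by blast
    then show "A \<subseteq> B \<or> B \<subseteq> A"
      using mono[of m n] mono[of n m] by (cases "m \<le> n") auto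
  qed
  then have "\<Union>(range I) \<in> range I"
    by (intro R.ideal_chain_is_trivial) auto
  then obtain N where N: "(\<Union>n. I n) = I N"
    by auto
  have "u N = (\<Sum>i<Suc N. (if i = N then 1 else 0) * u i)"
    by simp
  then have "u N \<in> I (Suc N)"
    unfolding I_def by (intro CollectI exI[of _ "\<lambda>i. if i = N then 1 else 0"]) simp
  then have "u N \<in> I N"
    using N by blast
  then obtain r where r: "u N = (\<Sum>i<N. r i * u i)"
    unfolding I_def by blast

  define t where "t = to_fract b / to_fract d"
  have t: "t ^ n * to_fract a = to_fract (u n)" for n
  proof (induction n)
    case (Suc n)
    have "to_fract d * (t ^ Suc n * to_fract a) = to_fract b * to_fract (u n)"
      using \<open>d \<noteq> 0\<close> Suc by (simp add: t_def algebra_simps)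
    also have "\<dots> = to_fract d * to_fract (u (Suc n))"
      using u(2)[of n] by (simp flip: to_fract_mult)
    finally show ?case
      using \<open>d \<noteq> 0\<close> mult_left_cancel to_fract_eq_0_iff by blast
  qed (simp add: u_def)
  have "t ^ N * to_fract a = (\<Sum>i<N. to_fract (r i) * t ^ i) * to_fract a"
    by (simp add: t r to_fract_sum sum_distrib_right mult.assoc)
  then have tN: "t ^ N = (\<Sum>i<N. to_fract (r i) * t ^ i)"
    using \<open>a \<noteq> 0\<close> by simp
  define p where "p = monom 1 N - (\<Sum>i<N. monom (r i) i)"
  have coeff: "coeff p i = (if i = N then 1 else if i < N then - r i else 0)" for i
    by (auto simp: p_def coeff_sum)
  have deg: "degree p = N"
    by (intro antisym degree_le le_degree) (auto simp: coeff)
  have "poly (map_poly to_fract p) t = (\<Sum>i\<le>N. to_fract (coeff p i) * t ^ i)"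
    by (simp add: poly_altdef degree_map_poly coeff_map_poly deg)
  also have "\<dots> = t ^ N - (\<Sum>i<N. to_fract (r i) * t ^ i)"
    by (simp add: coeff sum_negf flip: lessThan_Suc_atMost)
  also have "\<dots> = 0"
    using tN by simp
  finally have "poly (map_poly to_fract p) t = 0" .
  moreover have "lead_coeff p = 1"
    by (simp add: coeff deg)
  ultimately have "t \<in> range to_fract"
    using closed unfolding integrally_closed_def by blast
  then obtain c where "t = to_fract c" by blast
  then have "to_fract b = to_fract (c * d)"
    using \<open>d \<noteq> 0\<close> by (simp add: t_def field_simps)
  then have "b = c * d"
    by (simp only: to_fract_eq_iff)
  then show ?thesis
    by simp
qed

text \<open>
  The maximal ideal \<open>P\<close> is an associated prime of \<open>R / d R\<close>: starting from \<open>b = 1\<close>, one multiplies \<open>b\<close>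
  by powers of generators of \<open>P\<close>, without making \<open>b\<close> divisible by \<open>d\<close> in the localization at \<open>P\<close>.
\<close>

lemma exists_multiplier_into_principal:
  fixes d :: "'a::idom"
  assumes dim: "krull_dim (ring_of TYPE('a)) = 1" and noeth: "noetherian_ring (ring_of TYPE('a))"
    and P: "primeideal P (ring_of TYPE('a))" and d: "d \<in> P" "d \<noteq> 0"
  obtains b where "\<not> d dvd b" "\<And>p. p \<in> P \<Longrightarrow> d dvd b * p"
proof -
  interpret R: noetherian_ring "ring_of TYPE('a)" by (rule noeth)
  have fin: "\<exists>b. (\<forall>s. s \<notin> P \<longrightarrow> \<not> d dvd s * b) \<and> (\<forall>p\<in>F. d dvd b * p)"
    if "finite F" "F \<subseteq> P" for F
    using that
  proof (induction F)
    case empty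
    show ?case
      using prime_dvd_mem[OF P d(1)] by (intro exI[of _ 1]) auto
  next
    case (insert p F)
    then obtain b where b: "\<And>s. s \<notin> P \<Longrightarrow> \<not> d dvd s * b" and bF: "\<And>p. p \<in> F \<Longrightarrow> d dvd b * p"
      by auto
    \<comment> \<open>\<open>Q m\<close> says that \<open>d\<close> divides \<open>p ^ m * b\<close>
      in the localization at \<open>P\<close>. It fails at \<open>0\<close> and holds at some
      \<open>n\<close>; an exponent just before it becomes true gives the new multiplier, up to a
      factor \<open>s\<close> outside \<open>P\<close>.\<close>
    define Q where "Q m \<longleftrightarrow> (\<exists>s. s \<notin> P \<and> d dvd s * (p ^ m * b))" for m
    obtain n y where ny: "d dvd p ^ n * (1 - p * y)"
      using pi_regular_modulo[OF dim d(2)] by blast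
    have "p * y \<in> P"
      using insert.prems P by (simp add: prime_mult_iff)
    then have "1 - p * y \<notin> P"
      using P ideal_add_iff[of P "p * y" "1 - p * y"] by (auto simp: primeideal_iff)
    moreover have "d dvd (1 - p * y) * (p ^ n * b)"
      using dvd_mult2[OF ny, of b] by (simp add: ac_simps)
    ultimately have "Q n"
      unfolding Q_def by blast
    moreover have "\<not> Q 0"
      unfolding Q_def using b by auto
    ultimately obtain k where "\<not> Q k" "Q (Suc k)"
      using ex_least_nat_less[of Q n] by auto
    then obtain s where s: "s \<notin> P" "d dvd s * (p ^ Suc k * b)"
      unfolding Q_def by blast
    show ?case
    proof (intro exI[of _ "s * (p ^ k * b)"] conjI allI impI ballI)
      fix u assume "u \<notin> P"
      then have "u * s \<notin> P"
        using s P by (simp add: prime_mult_iff)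
      then show "\<not> d dvd u * (s * (p ^ k * b))"
        using \<open>\<not> Q k\<close> unfolding Q_def by (metis mult.assoc)
    next
      fix q assume "q \<in> insert p F"
      then show "d dvd s * (p ^ k * b) * q"
      proof
        assume "q = p"
        then show ?thesis using s(2) by (simp add: ac_simps)
      next
        assume "q \<in> F"
        then show ?thesis using dvd_mult[OF bF, of q "s * p ^ k"] by (simp add: ac_simps)
      qed
    qed
  qed
  obtain F where F: "finite F" "P = Idl\<^bsub>ring_of TYPE('a)\<^esub> F"
    using R.finetely_gen[of P] P unfolding primeideal_iff by blast
  then have "F \<subseteq> P"
    using R.genideal_self[of F] by simp
  then obtain b where b: "\<And>s. s \<notin> P \<Longrightarrow> \<not> d dvd s * b" "\<And>p. p \<in> F \<Longrightarrow> d dvd b * p"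
    using fin[OF F(1)] by blast
  have "ideal {x. d dvd b * x} (ring_of TYPE('a))"
    unfolding ideal_iff
    by (auto simp: distrib_left mult.left_commute[of b])
  then have "P \<subseteq> {x. d dvd b * x}"
    unfolding F(2) using b(2) by (intro R.genideal_minimal) auto
  moreover have "\<not> d dvd b"
    using b(1)[of 1] P by (auto simp: primeideal_iff)
  ultimately show ?thesis
    using that by blast
qed

section \<open>Inverses of ideals\<close>

lemma ideal_colon: "ideal {r. \<forall>i\<in>I. a dvd r * i} (ring_of TYPE('a::comm_ring_1))"
  unfolding ideal_iff by (auto simp: distrib_right mult.assoc)

text \<open>Coding finite sums by lists of pairs makes addition concatenation; a scalar is absorbed
  into the first components.\<close>

lemma ideal_product:
  assumes I: "ideal I (ring_of TYPE('a::comm_ring_1))"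
  shows "ideal {\<Sum>(i, j)\<leftarrow>ps. i * j | ps. set ps \<subseteq> I \<times> J} (ring_of TYPE('a))" (is "ideal ?M _")
  unfolding ideal_iff
proof (intro conjI ballI allI)
  show "0 \<in> ?M"
    by (intro CollectI exI[of _ "[]"]) simp
next
  fix x y assume "x \<in> ?M" "y \<in> ?M"
  then obtain ps qs where "x = (\<Sum>(i, j)\<leftarrow>ps. i * j)" "set ps \<subseteq> I \<times> J"
    "y = (\<Sum>(i, j)\<leftarrow>qs. i * j)" "set qs \<subseteq> I \<times> J"
    by auto
  then show "x + y \<in> ?M"
    by (intro CollectI exI[of _ "ps @ qs"]) auto
next
  fix x z assume "x \<in> ?M"
  then obtain ps where ps: "x = (\<Sum>(i, j)\<leftarrow>ps. i * j)" "set ps \<subseteq> I \<times> J"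
    by auto
  have "z * x = (\<Sum>(i, j)\<leftarrow>map (\<lambda>(i, j). (z * i, j)) ps. i * j)"
    unfolding ps(1) by (induction ps) (auto simp: algebra_simps)
  moreover have "set (map (\<lambda>(i, j). (z * i, j)) ps) \<subseteq> I \<times> J"
    using ps(2) ideal_mult_right[OF I] by auto
  ultimately show "z * x \<in> ?M"
    by blast
qed

text \<open>
  In fractional terms, with \<open>J / a\<close> the inverse of \<open>I\<close>, the ideal \<open>L = I (J / a)\<close> is all of \<open>R\<close>:
  otherwise some \<open>b / a\<close> outside \<open>R\<close> maps \<open>L\<close> into \<open>R\<close>, hence \<open>J\<close> into itself, and is integral.
\<close>

lemma dedekind_ideal_invertible:
  fixes a :: "'a::idom"
  assumes dim: "krull_dim (ring_of TYPE('a)) = 1" and noeth: "noetherian_ring (ring_of TYPE('a))"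
    and closed: "integrally_closed TYPE('a)"
    and I: "ideal I (ring_of TYPE('a))" and a: "a \<in> I" "a \<noteq> 0"
  obtains ps where "set ps \<subseteq> I \<times> {r. \<forall>i\<in>I. a dvd r * i}" "(\<Sum>(i, j)\<leftarrow>ps. i * j) = a"
proof -
  define J where "J = {r. \<forall>i\<in>I. a dvd r * i}"
  define M where "M = {\<Sum>(i, j)\<leftarrow>ps. i * j | ps. set ps \<subseteq> I \<times> J}"
  have M: "ideal M (ring_of TYPE('a))"
    unfolding M_def by (rule ideal_product[OF I])
  have prod: "i * j \<in> M" if "i \<in> I" "j \<in> J" for i j
    unfolding M_def using that by (intro CollectI exI[of _ "[(i, j)]"]) auto
  define L where "L = {l. a * l \<in> M}"
  have L: "ideal L (ring_of TYPE('a))"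
    using M unfolding ideal_iff L_def by (auto simp: distrib_left mult.left_commute[of a])
  have "a \<in> J"
    unfolding J_def by simp
  have "1 \<in> L"
  proof (rule ccontr)
    assume "1 \<notin> L"
    then obtain P where P: "primeideal P (ring_of TYPE('a))" "L \<subseteq> P"
      using exists_prime_disjoint[OF L, of "{1}"] by auto
    have "a \<in> L"
      using prod[OF a(1) \<open>a \<in> J\<close>] by (simp add: L_def)
    then have "a \<in> P"
      using P(2) by blast
    then obtain b where b: "\<not> a dvd b" "\<And>p. p \<in> P \<Longrightarrow> a dvd b * p"
      using exists_multiplier_into_principal[OF dim noeth P(1) _ a(2)] by blast
    \<comment> \<open>In fractional terms, \<open>(b / a) * (j / a) * i\<close> lies in
      \<open>R\<close>.\<close>
    have key: "\<exists>l. b * j * i = a * a * l" if "j \<in> J" "i \<in> I" for i j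
    proof -
      obtain l where l: "j * i = a * l"
        using \<open>j \<in> J\<close> \<open>i \<in> I\<close> unfolding J_def by (auto elim: dvdE)
      then have "l \<in> L"
        using prod[OF \<open>i \<in> I\<close> \<open>j \<in> J\<close>] by (simp add: L_def mult.commute)
      then obtain l' where "b * l = a * l'"
        using b(2)[of l] P(2) by (auto elim: dvdE)
      then have "b * j * i = a * a * l'"
        using l by (metis mult.assoc mult.left_commute)
      then show ?thesis by blast
    qed
    have "\<exists>j'\<in>J. b * j = a * j'" if "j \<in> J" for j
    proof -
      obtain j' where "b * j * a = a * a * j'"
        using key[OF \<open>j \<in> J\<close> a(1)] by blast
      then have "a * (b * j) = a * (a * j')"
        by (simp add: ac_simps)
      then have j': "b * j = a * j'"
        using a(2) mult_left_cancel by blast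
      have "a dvd j' * i" if "i \<in> I" for i
      proof -
        obtain l where "b * j * i = a * a * l"
          using key[OF \<open>j \<in> J\<close> \<open>i \<in> I\<close>] by blast
        then have "a * (j' * i) = a * (a * l)"
          by (simp add: j' mult.assoc)
        then show ?thesis
          using a(2) by simp
      qed
      then show ?thesis
        using j' unfolding J_def by blast
    qed
    then have "a dvd b"
      by (rule dvd_if_stabilizes_ideal[OF noeth closed \<open>a \<in> J\<close> a(2) a(2)])
    then show False
      using b(1) by blast
  qed
  then have "a \<in> M"
    by (simp add: L_def)
  then show ?thesis
    unfolding M_def J_def by (elim CollectE exE conjE) (rule that, auto)
qed

text \<open>Invertibility writes \<open>1\<close> as the sum of the \<open>u k * v k / a\<close>, so
  the \<open>v k * u l / a\<close> form a matrix of rank one and trace one. A value \<open>1\<close>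
  of its form factors \<open>a\<close> as \<open>h * g\<close> with \<open>h\<close> in
  \<open>J\<close> and \<open>g\<close> in \<open>I\<close>, and cancelling \<open>h\<close> from
  \<open>h I \<subseteq> a R\<close> leaves \<open>I \<subseteq> g R\<close>.\<close>

lemma principal_domain_if_Pi2_ring:
  assumes dim: "krull_dim (ring_of TYPE('a::idom)) = 1" and ded: "dedekind_domain TYPE('a)"
    and Pi2: "Pi2_ring TYPE('a)"
  shows "principal_domain (ring_of TYPE('a))"
proof (intro principal_domain.intro domain_ring_of principal_domain_axioms.intro)
  fix I assume I: "ideal I (ring_of TYPE('a))"
  have "\<exists>g. I = {x * g | x. True}"
  proof (cases "I = {0}")
    case True
    then show ?thesis by (intro exI[of _ 0]) auto
  next
    case False
    then obtain a where a: "a \<in> I" "a \<noteq> 0"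
      using I unfolding ideal_iff by blast
    define J where "J = {r. \<forall>i\<in>I. a dvd r * i}"
    have J: "ideal J (ring_of TYPE('a))"
      unfolding J_def by (rule ideal_colon)
    obtain ps where ps: "set ps \<subseteq> I \<times> J" "(\<Sum>(i, j)\<leftarrow>ps. i * j) = a"
      using dedekind_ideal_invertible[OF dim _ _ I a] ded unfolding dedekind_domain_def J_def
      by blast
    define n where "n = length ps"
    define u v where "u k = fst (ps ! k)" and "v k = snd (ps ! k)" for k
    have uv: "u k \<in> I" "v k \<in> J" if "k < n" for k
      using subsetD[OF ps(1) nth_mem, of k] that unfolding n_def u_def v_def by auto
    have sum: "(\<Sum>k<n. v k * u k) = a"
      using ps(2) by (simp add: sum_list_sum_nth n_def u_def v_def case_prod_beta mult.commute
        atLeast0LessThan)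
    have "\<exists>e. v k * u l = a * e" if "k < n" "l < n" for k l
      using uv(2)[OF that(1)] uv(1)[OF that(2)] unfolding J_def dvd_def by blast
    then obtain E where E: "\<And>k l. k < n \<Longrightarrow> l < n \<Longrightarrow> v k * u l = a * E k l"
      by metis
    have "E i j * E k l = E i l * E k j" if "i < n" "j < n" "k < n" "l < n" for i j k l
    proof -
      have "(a * E i j) * (a * E k l) = (a * E i l) * (a * E k j)"
        using that by (simp add: ac_simps flip: E)
      then show ?thesis
        using a(2) by simp
    qed
    moreover have "(\<Sum>i<n. E i i) = 1"
    proof -
      have "a * (\<Sum>i<n. E i i) = a * 1"
        using sum by (simp add: sum_distrib_left flip: E)
      then show ?thesis
        using a(2) mult_left_cancel by blast
    qed
    ultimately obtain t z where tz: "bilin n E t z = 1"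
      by (rule bilin_represents_one[OF dim Pi2])
    define g h where "g = (\<Sum>l<n. z l * u l)" and "h = (\<Sum>k<n. t k * v k)"
    have "a * bilin n E t z = (\<Sum>k<n. \<Sum>l<n. t k * (z l * (a * E k l)))"
      by (simp add: bilin_def sum_distrib_left ac_simps)
    also have "\<dots> = (\<Sum>k<n. \<Sum>l<n. t k * (z l * (v k * u l)))"
      by (intro sum.cong refl) (simp add: E)
    also have "\<dots> = h * g"
      by (simp add: g_def h_def sum_product ac_simps)
    finally have hg: "a = h * g"
      by (simp add: tz)
    have "g \<in> I"
      unfolding g_def using uv ideal_mult_right[OF I] by (intro ideal_sum[OF I]) auto
    have "h \<in> J"
      unfolding h_def using uv ideal_mult_right[OF J] by (intro ideal_sum[OF J]) auto
    have "I = {x * g | x. True}"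
    proof (intro equalityI subsetI)
      fix i assume "i \<in> I"
      then obtain c where "h * i = a * c"
        using \<open>h \<in> J\<close> unfolding J_def by (auto elim: dvdE)
      then have "h * i = h * (c * g)"
        by (simp add: hg ac_simps)
      then have "i = c * g"
        using a(2) hg by auto
      then show "i \<in> {x * g | x. True}" by blast
    qed (use \<open>g \<in> I\<close> ideal_mult_right[OF I] in auto)
    then show ?thesis by blast
  qed
  then show "\<exists>a\<in>carrier (ring_of TYPE('a)). I = PIdl\<^bsub>ring_of TYPE('a)\<^esub> a"
    unfolding cgenideal_def by auto
qed


section \<open>Line bundles\<close>

lemma free_module_sel [simp]:
  "carrier (free_module (ring_of TYPE('a::comm_ring_1)) n) = {v. \<forall>i\<ge>n. v i = 0}"
  "ring.zero (free_module (ring_of TYPE('a)) n) = (\<lambda>i. 0)"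
  "add (free_module (ring_of TYPE('a)) n) = (\<lambda>v w i. v i + w i)"
  "module.smult (free_module (ring_of TYPE('a)) n) = (\<lambda>a v i. a * v i)"
  by (auto simp: free_module_def)

lemma module_free_submodule:
  assumes H: "(\<lambda>i. 0) \<in> H" "\<And>v w. v \<in> H \<Longrightarrow> w \<in> H \<Longrightarrow> (\<lambda>i. v i + w i) \<in> H"
    "\<And>a v. v \<in> H \<Longrightarrow> (\<lambda>i. a * v i) \<in> H"
  shows "Module.module (ring_of TYPE('a::comm_ring_1)) (free_module (ring_of TYPE('a)) n\<lparr>carrier := H\<rparr>)"
    (is "Module.module _ ?M")
proof (rule moduleI)
  show "abelian_group ?M"
  proof (rule abelian_groupI)
    fix v assume "v \<in> carrier ?M"
    then have "(\<lambda>i. - 1 * v i) \<in> H"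
      using H(3)[where a = "- 1"] by simp
    then show "\<exists>w\<in>carrier ?M. w \<oplus>\<^bsub>?M\<^esub> v = \<zero>\<^bsub>?M\<^esub>"
      by (intro bexI[of _ "\<lambda>i. - 1 * v i"]) auto
  qed (use H in \<open>auto simp: algebra_simps\<close>)
qed (use H in \<open>auto simp: cring_ring_of algebra_simps\<close>)

lemma module_free_module:
  "Module.module (ring_of TYPE('a::comm_ring_1)) (free_module (ring_of TYPE('a)) n)"
  using module_free_submodule[of "{v :: nat \<Rightarrow> 'a. \<forall>i\<ge>n. v i = 0}" n]
  by (simp add: free_module_def)

section \<open>Homomorphisms and isomorphisms of modules\<close>

lemma module_homD:
  assumes "f \<in> module_hom R M N"
  shows "x \<in> carrier M \<Longrightarrow> f x \<in> carrier N"
    "x \<in> carrier M \<Longrightarrow> y \<in> carrier M \<Longrightarrow> f (x \<oplus>\<^bsub>M\<^esub> y) = f x \<oplus>\<^bsub>N\<^esub> f y"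
    "a \<in> carrier R \<Longrightarrow> x \<in> carrier M \<Longrightarrow> f (a \<odot>\<^bsub>M\<^esub> x) = a \<odot>\<^bsub>N\<^esub> f x"
  using assms by (auto simp: module_hom_def)

lemma module_homI:
  assumes "\<And>x. x \<in> carrier M \<Longrightarrow> f x \<in> carrier N"
    and "\<And>x y. x \<in> carrier M \<Longrightarrow> y \<in> carrier M \<Longrightarrow> f (x \<oplus>\<^bsub>M\<^esub> y) = f x \<oplus>\<^bsub>N\<^esub> f y"
    and "\<And>a x. a \<in> carrier R \<Longrightarrow> x \<in> carrier M \<Longrightarrow> f (a \<odot>\<^bsub>M\<^esub> x) = a \<odot>\<^bsub>N\<^esub> f x"
  shows "f \<in> module_hom R M N"
  using assms by (auto simp: module_hom_def)

lemma module_hom_compose: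
  assumes f: "f \<in> module_hom R M N" and g: "g \<in> module_hom R N L"
  shows "g \<circ> f \<in> module_hom R M L"
  by (rule module_homI) (simp_all add: module_homD[OF f] module_homD[OF g])

lemma module_hom_inv_into:
  assumes M: "Module.module R M" and f: "f \<in> module_hom R M N"
    and bij: "bij_betw f (carrier M) (carrier N)"
  shows "inv_into (carrier M) f \<in> module_hom R N M"
proof -
  interpret M: Module.module R M by (rule M)
  let ?g = "inv_into (carrier M) f"
  have g: "?g y \<in> carrier M" "f (?g y) = y" if "y \<in> carrier N" for y
    using bij that by (auto simp: bij_betw_def inv_into_into f_inv_into_f)
  have gf: "?g (f x) = x" if "x \<in> carrier M" for x
    using bij that by (simp add: bij_betw_def)
  show ?thesis
  proof (rule module_homI)
    fix y z assume yz: "y \<in> carrier N" "z \<in> carrier N"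
    then have "?g (y \<oplus>\<^bsub>N\<^esub> z) = ?g (f (?g y \<oplus>\<^bsub>M\<^esub> ?g z))"
      by (simp add: g module_homD[OF f])
    then show "?g (y \<oplus>\<^bsub>N\<^esub> z) = ?g y \<oplus>\<^bsub>M\<^esub> ?g z"
      using yz by (simp add: gf g)
  next
    fix a y assume ay: "a \<in> carrier R" "y \<in> carrier N"
    then have "?g (a \<odot>\<^bsub>N\<^esub> y) = ?g (f (a \<odot>\<^bsub>M\<^esub> ?g y))"
      by (simp add: g module_homD[OF f])
    then show "?g (a \<odot>\<^bsub>N\<^esub> y) = a \<odot>\<^bsub>M\<^esub> ?g y"
      using ay by (simp add: gf g)
  qed (rule g)
qed

lemma module_iso_refl: "module_iso R M M"
  unfolding module_iso_def by (intro bexI[of _ id] module_homI) auto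

lemma module_iso_sym:
  assumes "Module.module R M" "module_iso R M N"
  shows "module_iso R N M"
  using assms module_hom_inv_into bij_betw_inv_into unfolding module_iso_def by metis

lemma module_iso_trans:
  assumes "module_iso R M N" "module_iso R N L"
  shows "module_iso R M L"
  using assms module_hom_compose bij_betw_trans unfolding module_iso_def by metis

lemma line_bundle_free: "free_module (ring_of TYPE('a::comm_ring_1)) 1 \<in> line_bundles (ring_of TYPE('a))"
proof -
  let ?R = "ring_of TYPE('a)" and ?F = "free_module (ring_of TYPE('a)) 1"
  have "fg_projective ?R ?F"
    unfolding fg_projective_def
    by (intro conjI module_free_module exI[of _ 1] bexI[of _ id]) (auto simp: module_hom_def)
  moreover have "rank_one_at ?R ?F P" if P: "primeideal P ?R" for P
    unfolding rank_one_at_def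
  proof (intro bexI[of _ "unit_vec 0"] conjI ballI impI)
    fix x assume "x \<in> carrier ?F"
    then have "1 \<odot>\<^bsub>?F\<^esub> x = x 0 \<odot>\<^bsub>?F\<^esub> unit_vec 0"
      by (auto simp: unit_vec_def)
    then show "\<exists>s\<in>carrier ?R - P. \<exists>r\<in>carrier ?R. s \<odot>\<^bsub>?F\<^esub> x = r \<odot>\<^bsub>?F\<^esub> unit_vec 0"
      using P by (intro bexI[of _ 1] bexI[of _ "x 0"]) (auto simp: primeideal_iff)
  next
    fix r assume "\<exists>s\<in>carrier ?R - P. s \<odot>\<^bsub>?F\<^esub> (r \<odot>\<^bsub>?F\<^esub> unit_vec 0) = \<zero>\<^bsub>?F\<^esub>"
    then obtain s where s: "s \<notin> P" "(\<lambda>i. s * (r * unit_vec 0 i)) = (\<lambda>i. 0)"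
      by auto
    have "s * r = 0"
      using fun_cong[OF s(2), of 0] by (simp add: unit_vec_def)
    then show "\<exists>s\<in>carrier ?R - P. s \<otimes>\<^bsub>?R\<^esub> r = \<zero>\<^bsub>?R\<^esub>"
      using s(1) by auto
  qed (auto simp: unit_vec_def)
  ultimately show ?thesis
    by (simp add: line_bundles_def rank_one_projective_def)
qed

lemma line_bundle_module: "M \<in> line_bundles R \<Longrightarrow> Module.module R M"
  by (simp add: line_bundles_def rank_one_projective_def fg_projective_def)

text \<open>Linearity is assumed only on sequences vanishing from \<open>n\<close> on, so
  \<open>v\<close> is built up through its truncations.\<close>

lemma linear_functional_eq:
  fixes L :: "(nat \<Rightarrow> 'a::comm_ring_1) \<Rightarrow> 'a"
  assumes add: "\<And>v w. \<forall>i\<ge>n. v i = 0 \<Longrightarrow> \<forall>i\<ge>n. w i = 0 \<Longrightarrow> L (\<lambda>i. v i + w i) = L v + L w"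
    and smult: "\<And>a v. \<forall>i\<ge>n. v i = 0 \<Longrightarrow> L (\<lambda>i. a * v i) = a * L v"
    and v: "\<forall>i\<ge>n. v i = 0"
  shows "L v = (\<Sum>j<n. v j * L (unit_vec j))"
proof -
  have "L (\<lambda>i. if i < k then v i else 0) = (\<Sum>j<k. v j * L (unit_vec j))" if "k \<le> n" for k
    using that
  proof (induction k)
    case 0
    show ?case
      using smult[of "\<lambda>i. 0" 0] by simp
  next
    case (Suc k)
    have "(\<lambda>i. if i < Suc k then v i else 0) =
        (\<lambda>i. (if i < k then v i else 0) + v k * unit_vec k i)"
      by (auto simp: unit_vec_def less_Suc_eq)
    then have "L (\<lambda>i. if i < Suc k then v i else 0) =
        L (\<lambda>i. (if i < k then v i else 0) + v k * unit_vec k i)"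
      by simp
    also have "\<dots> = L (\<lambda>i. if i < k then v i else 0) + L (\<lambda>i. v k * unit_vec k i)"
      using Suc.prems v by (intro add) (auto simp: unit_vec_def)
    also have "L (\<lambda>i. v k * unit_vec k i) = v k * L (unit_vec k)"
      using Suc.prems by (intro smult) (auto simp: unit_vec_def)
    finally show ?case
      using Suc by simp
  qed
  moreover have "(\<lambda>i. if i < n then v i else 0) = v"
    using v by (auto simp: not_less)
  ultimately show ?thesis
    using order_refl[of n] by metis
qed

text \<open>
  The projection of \<open>R\<^sup>n\<close> onto a line bundle \<open>M\<close> is a matrix of rank one and trace one; a vector and a
  covector on which it takes the value \<open>1\<close> provide a generator of \<open>M\<close> and its coordinate.
\<close>

lemma line_bundle_trivial:
  fixes M :: "('a::idom, 'm) module"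
  assumes dim: "krull_dim (ring_of TYPE('a)) = 1" and Pi2: "Pi2_ring TYPE('a)"
    and M: "rank_one_projective (ring_of TYPE('a)) M"
  shows "module_iso (ring_of TYPE('a)) (free_module (ring_of TYPE('a)) 1) M"
proof -
  let ?R = "ring_of TYPE('a)"
  have fg: "fg_projective ?R M" and rk: "\<And>P. primeideal P ?R \<Longrightarrow> rank_one_at ?R M P"
    using M by (auto simp: rank_one_projective_def)
  then interpret M: Module.module ?R M
    by (simp add: fg_projective_def)
  obtain n f g where f: "f \<in> module_hom ?R M (free_module ?R n)"
    and g: "g \<in> module_hom ?R (free_module ?R n) M"
    and gf: "\<And>x. x \<in> carrier M \<Longrightarrow> g (f x) = x"
    using fg unfolding fg_projective_def by blast
  have f0: "f x i = 0" if "x \<in> carrier M" "i \<ge> n" for x i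
    using module_homD(1)[OF f] that by auto
  have fadd: "f (x \<oplus>\<^bsub>M\<^esub> y) = (\<lambda>i. f x i + f y i)" if "x \<in> carrier M" "y \<in> carrier M" for x y
    using module_homD(2)[OF f] that by simp
  have fsm: "f (a \<odot>\<^bsub>M\<^esub> x) = (\<lambda>i. a * f x i)" if "x \<in> carrier M" for a x
    using module_homD(3)[OF f] that by simp
  have gM: "g v \<in> carrier M" if "\<forall>i\<ge>n. v i = 0" for v
    using module_homD(1)[OF g] that by simp
  have gadd: "g (\<lambda>i. v i + w i) = g v \<oplus>\<^bsub>M\<^esub> g w" if "\<forall>i\<ge>n. v i = 0" "\<forall>i\<ge>n. w i = 0" for v w
    using module_homD(2)[OF g] that by simp
  have gsm: "g (\<lambda>i. a * v i) = a \<odot>\<^bsub>M\<^esub> g v" if "\<forall>i\<ge>n. v i = 0" for a v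
    using module_homD(3)[OF g] that by simp
  have u: "\<forall>i\<ge>n. unit_vec j i = (0::'a)" if "j < n" for j
    using that by (simp add: unit_vec_def)
  define E where "E i j = f (g (unit_vec j)) i" for i j
  have fg_eq: "f (g v) i = (\<Sum>j<n. v j * E i j)" if "\<forall>i\<ge>n. v i = 0" for v i
    unfolding E_def
    by (rule linear_functional_eq[where L = "\<lambda>v. f (g v) i", OF _ _ that])
      (simp_all add: gadd gsm fadd fsm gM)
  have f_eq: "f x i = (\<Sum>j<n. f x j * E i j)" if "x \<in> carrier M" for x i
    using fg_eq[of "f x" i] f0 gf that by simp
  \<comment> \<open>Rank one at the zero prime makes all columns of \<open>E\<close> proportional to
    \<open>f m\<close> over the fraction field; the vanishing of the minors descends to the domain
    \<open>R\<close>.\<close>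
  have "primeideal {0} ?R"
    by (simp add: primeideal_iff ideal_iff)
  then have "rank_one_at ?R M {0}"
    by (rule rk)
  then obtain m where m: "m \<in> carrier M"
    and m1: "\<forall>x\<in>carrier M. \<exists>s\<in>carrier ?R - {0}. \<exists>r\<in>carrier ?R. s \<odot>\<^bsub>M\<^esub> x = r \<odot>\<^bsub>M\<^esub> m"
    and m2: "\<forall>r\<in>carrier ?R. (\<exists>s\<in>carrier ?R - {0}. s \<odot>\<^bsub>M\<^esub> (r \<odot>\<^bsub>M\<^esub> m) = \<zero>\<^bsub>M\<^esub>) \<longrightarrow>
      (\<exists>s\<in>carrier ?R - {0}. s \<otimes>\<^bsub>?R\<^esub> r = \<zero>\<^bsub>?R\<^esub>)"
    unfolding rank_one_at_def by blast
  have span: "\<exists>s. s \<noteq> 0 \<and> (\<exists>r. s \<odot>\<^bsub>M\<^esub> x = r \<odot>\<^bsub>M\<^esub> m)" if "x \<in> carrier M" for x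
    using m1 that by auto
  have free: "r = 0" if "s \<noteq> 0" "s \<odot>\<^bsub>M\<^esub> (r \<odot>\<^bsub>M\<^esub> m) = \<zero>\<^bsub>M\<^esub>" for r s
    using m2 that by auto
  have rank: "E i j * E k l = E i l * E k j" if ijkl: "i < n" "j < n" "k < n" "l < n" for i j k l
  proof -
    obtain s r where sr: "s \<noteq> 0" "s \<odot>\<^bsub>M\<^esub> g (unit_vec j) = r \<odot>\<^bsub>M\<^esub> m"
      using span[OF gM[OF u[OF ijkl(2)]]] by blast
    obtain s' r' where sr': "s' \<noteq> 0" "s' \<odot>\<^bsub>M\<^esub> g (unit_vec l) = r' \<odot>\<^bsub>M\<^esub> m"
      using span[OF gM[OF u[OF ijkl(4)]]] by blast
    have 1: "s * E i j = r * f m i" for i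
      using arg_cong[OF sr(2), of "\<lambda>x. f x i"] by (simp add: E_def fsm m gM u ijkl)
    have 2: "s' * E i l = r' * f m i" for i
      using arg_cong[OF sr'(2), of "\<lambda>x. f x i"] by (simp add: E_def fsm m gM u ijkl)
    have "(s * E i j) * (s' * E k l) = (s' * E i l) * (s * E k j)"
      by (simp add: 1 2 ac_simps)
    then have "(s * s') * (E i j * E k l) = (s * s') * (E i l * E k j)"
      by (simp add: ac_simps)
    then show ?thesis
      using sr(1) sr'(1) by simp
  qed
  have "\<exists>k<n. \<exists>l<n. E k l \<noteq> 0"
  proof (rule ccontr)
    assume "\<not> ?thesis"
    then have "f m i = 0" for i
      using f_eq[OF m, of i] f0[OF m, of i] by (cases "i < n") auto
    then have "f m = (\<lambda>i. 0 * f m i)"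
      by auto
    then have "g (f m) = 0 \<odot>\<^bsub>M\<^esub> g (f m)"
      using gsm[of "f m" 0] f0[OF m] by simp
    then have "m = \<zero>\<^bsub>M\<^esub>"
      using m M.smult_l_null gf by simp
    moreover have "1 \<odot>\<^bsub>M\<^esub> (1 \<odot>\<^bsub>M\<^esub> \<zero>\<^bsub>M\<^esub>) = \<zero>\<^bsub>M\<^esub>"
      using M.smult_r_null by simp
    ultimately show False
      using free[of 1 1] by simp
  qed
  then obtain k l where kl: "k < n" "l < n" "E k l \<noteq> 0" by blast
  \<comment> \<open>\<open>E\<close> is idempotent, and for rank one its square is the trace times
    \<open>E\<close>; a nonzero entry can be cancelled.\<close>
  have "E k l = (\<Sum>j<n. E j l * E k j)"
    using f_eq[of "g (unit_vec l)" k] kl by (simp add: E_def gM u)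
  also have "\<dots> = (\<Sum>j<n. E k l * E j j)"
    using kl rank by (intro sum.cong refl) (simp add: mult.commute)
  finally have "E k l * (\<Sum>j<n. E j j) = E k l * 1"
    by (simp add: sum_distrib_left)
  then have trace: "(\<Sum>j<n. E j j) = 1"
    using kl(3) mult_left_cancel by blast
  obtain t z where tz: "bilin n E t z = 1"
    by (rule bilin_represents_one[OF dim Pi2 rank trace])
  \<comment> \<open>Elements of the free module vanish from \<open>n\<close> on, whereas
    \<open>z\<close> is arbitrary there; the value of the form is the same.\<close>
  define z' where "z' i = (if i < n then z i else 0)" for i
  have z': "\<forall>i\<ge>n. z' i = 0"
    by (simp add: z'_def)
  define x0 where "x0 = g z'"
  have x0: "x0 \<in> carrier M"
    unfolding x0_def by (rule gM[OF z'])
  have fx0: "f x0 i = (\<Sum>j<n. z j * E i j)" for i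
    unfolding x0_def fg_eq[OF z'] by (intro sum.cong refl) (simp add: z'_def)
  define \<psi> where "\<psi> x = (\<Sum>i<n. t i * f x i)" for x
  have \<psi>_bilin: "\<psi> x = bilin n E t (f x)" if "x \<in> carrier M" for x
    unfolding \<psi>_def bilin_def
    by (intro sum.cong refl arg_cong[where f = "\<lambda>x. _ * x"] f_eq[OF that])
  have \<psi>x0: "\<psi> x0 = 1"
    using tz by (simp add: \<psi>_def fx0 bilin_def)
  have \<psi>sm: "\<psi> (a \<odot>\<^bsub>M\<^esub> x) = a * \<psi> x" if "x \<in> carrier M" for a x
    by (simp add: \<psi>_def fsm that sum_distrib_left ac_simps)
  \<comment> \<open>As \<open>E\<close> fixes \<open>f x\<close>, exchanging \<open>z\<close> and
    \<open>f x\<close> in the rank one identity, with a unit vector as second covector, gives each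
    coordinate.\<close>
  have gen: "x = \<psi> x \<odot>\<^bsub>M\<^esub> x0" if x: "x \<in> carrier M" for x
  proof -
    have "f x i = \<psi> x * f x0 i" for i
    proof (cases "i < n")
      case True
      have *: "bilin n E (unit_vec i) w = (\<Sum>j<n. w j * E i j)" for w
        using True by (simp add: bilin_def unit_vec_def if_distrib[of "\<lambda>x. x * _"] sum.delta
            cong: if_cong)
      have "bilin n E t z * bilin n E (unit_vec i) (f x) =
          bilin n E t (f x) * bilin n E (unit_vec i) z"
        by (rule bilin_rank_one[OF rank])
      moreover have "bilin n E (unit_vec i) (f x) = f x i"
        unfolding * by (rule f_eq[OF x, symmetric])
      ultimately show ?thesis
        by (simp add: tz * fx0 \<psi>_bilin[OF x])
    next
      case False
      then show ?thesis
        using f0 x x0 by simp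
    qed
    then have "f x = f (\<psi> x \<odot>\<^bsub>M\<^esub> x0)"
      using fsm[OF x0] by auto
    then show ?thesis
      using gf x x0 M.smult_closed[of "\<psi> x" x0] by (metis UNIV_I ring_of_sel(1))
  qed
  let ?h = "\<lambda>v. v 0 \<odot>\<^bsub>M\<^esub> x0"
  have "?h \<in> module_hom ?R (free_module ?R 1) M"
    using M.smult_closed[OF _ x0] M.smult_l_distr[OF _ _ x0] M.smult_assoc1[OF _ _ x0]
    by (intro module_homI) simp_all
  moreover have "bij_betw ?h (carrier (free_module ?R 1)) (carrier M)"
  proof (rule bij_betwI)
    show "?h \<in> carrier (free_module ?R 1) \<rightarrow> carrier M"
      using M.smult_closed[OF _ x0] by simp
    show "(\<lambda>x i. if i = 0 then \<psi> x else 0) \<in> carrier M \<rightarrow> carrier (free_module ?R 1)"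
      by simp
    show "?h (\<lambda>i. if i = 0 then \<psi> x else 0) = x" if "x \<in> carrier M" for x
      using gen[OF that] by simp
    show "(\<lambda>i. if i = 0 then \<psi> (?h v) else 0) = v" if "v \<in> carrier (free_module ?R 1)" for v
      using that by (auto simp: \<psi>sm[OF x0] \<psi>x0)
  qed
  ultimately show ?thesis
    unfolding module_iso_def by blast
qed


section \<open>The Picard group\<close>

text \<open>Multiplication of \<open>R\<close> is the universal bilinear map on \<open>R\<close> and
  \<open>R\<close>, since a bilinear map there is determined by its value at the unit vectors. Here
  it is the pointwise product of sequences supported at index \<open>0\<close>, carried to
  \<open>T\<close> by an isomorphism.\<close>

lemma tensor_product_free_1:
  fixes T :: "('a::comm_ring_1, nat \<Rightarrow> 'a) module"
  assumes T: "Module.module (ring_of TYPE('a)) T"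
    and iso: "module_iso (ring_of TYPE('a)) (free_module (ring_of TYPE('a)) 1) T"
  shows "tensor_product (ring_of TYPE('a)) (free_module (ring_of TYPE('a)) 1)
    (free_module (ring_of TYPE('a)) 1) T"
proof -
  let ?R = "ring_of TYPE('a)" and ?F = "free_module (ring_of TYPE('a)) 1"
  let ?u = "unit_vec 0 :: nat \<Rightarrow> 'a"
  obtain h where h: "h \<in> module_hom ?R ?F T" and bij: "bij_betw h (carrier ?F) (carrier T)"
    using iso unfolding module_iso_def by blast
  define g where "g = inv_into (carrier ?F) h"
  have g: "g \<in> module_hom ?R T ?F"
    unfolding g_def by (rule module_hom_inv_into[OF module_free_module h bij])
  have gh: "g (h v) = v" if "v \<in> carrier ?F" for v
    using bij that by (simp add: g_def bij_betw_def)
  have hg: "h (g x) = x" if "x \<in> carrier T" for x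
    using bij that by (simp add: g_def bij_betw_def f_inv_into_f)
  have u: "?u \<in> carrier ?F"
    by (simp add: unit_vec_def)
  define b where "b v w = h (\<lambda>i. v i * w i)" for v w
  have prodF: "(\<lambda>i. v i * w i) \<in> carrier ?F" if "v \<in> carrier ?F" for v w :: "nat \<Rightarrow> 'a"
    using that by simp
  have prod_smult: "(\<lambda>i. v i * w i) = v 0 \<odot>\<^bsub>?F\<^esub> w" "(\<lambda>i. v i * w i) = w 0 \<odot>\<^bsub>?F\<^esub> v"
    if "v \<in> carrier ?F" "w \<in> carrier ?F" for v w
  proof -
    have "v i * w i = v 0 * w i" "v i * w i = w 0 * v i" for i
      using that by (cases i; simp)+
    then show "(\<lambda>i. v i * w i) = v 0 \<odot>\<^bsub>?F\<^esub> w" "(\<lambda>i. v i * w i) = w 0 \<odot>\<^bsub>?F\<^esub> v"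
      by (simp_all only: free_module_sel)
  qed
  have hom1: "(\<lambda>w. b v w) \<in> module_hom ?R ?F T" if v: "v \<in> carrier ?F" for v
  proof (rule module_homI)
    fix w assume w: "w \<in> carrier ?F"
    show "b v w \<in> carrier T"
      unfolding b_def by (rule module_homD(1)[OF h prodF[OF v]])
    fix w' assume w': "w' \<in> carrier ?F"
    have "(\<lambda>i. v i * (w \<oplus>\<^bsub>?F\<^esub> w') i) = (\<lambda>i. v i * w i) \<oplus>\<^bsub>?F\<^esub> (\<lambda>i. v i * w' i)"
      by (simp add: distrib_left)
    then show "b v (w \<oplus>\<^bsub>?F\<^esub> w') = b v w \<oplus>\<^bsub>T\<^esub> b v w'"
      unfolding b_def using module_homD(2)[OF h prodF[OF v] prodF[OF v]] by simp
  next
    fix a w assume a: "a \<in> carrier ?R"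
    have "(\<lambda>i. v i * (a \<odot>\<^bsub>?F\<^esub> w) i) = a \<odot>\<^bsub>?F\<^esub> (\<lambda>i. v i * w i)"
      by (simp add: mult.left_commute)
    then show "b v (a \<odot>\<^bsub>?F\<^esub> w) = a \<odot>\<^bsub>T\<^esub> b v w"
      unfolding b_def using module_homD(3)[OF h a prodF[OF v]] by simp
  qed
  have comm: "b v w = b w v" for v w
    by (simp add: b_def mult.commute)
  have b: "b \<in> bilinear_maps ?R ?F ?F T"
    unfolding bilinear_maps_def using hom1 comm by simp
  have "\<exists>!f. f \<in> module_hom ?R T L \<inter> extensional (carrier T) \<and>
      (\<forall>x\<in>carrier ?F. \<forall>y\<in>carrier ?F. f (b x y) = c x y)"
    if L: "Module.module ?R L" and c: "c \<in> bilinear_maps ?R ?F ?F L"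
    for L :: "('a, nat \<Rightarrow> 'a) module" and c
  proof -
    have c1: "(\<lambda>w. c v w) \<in> module_hom ?R ?F L" if "v \<in> carrier ?F" for v
      using c that unfolding bilinear_maps_def by blast
    have c2: "(\<lambda>v. c v w) \<in> module_hom ?R ?F L" if "w \<in> carrier ?F" for w
      using c that unfolding bilinear_maps_def by blast
    interpret T: Module.module ?R T by (rule T)
    \<comment> \<open>The formula is forced by \<open>x = b (g x) ?u\<close>; the restriction is
      there because uniqueness is among extensional maps.\<close>
    define f where "f = restrict (\<lambda>x. c (g x) ?u) (carrier T)"
    have f: "f x = c (g x) ?u" if "x \<in> carrier T" for x
      using that by (simp add: f_def)
    have fhom: "f \<in> module_hom ?R T L"
    proof (rule module_homI)
      fix x assume "x \<in> carrier T"
      then show "f x \<in> carrier L"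
        unfolding f[OF \<open>x \<in> carrier T\<close>] by (intro module_homD(1)[OF c2[OF u]] module_homD(1)[OF g])
    next
      fix x y assume xy: "x \<in> carrier T" "y \<in> carrier T"
      have "f (x \<oplus>\<^bsub>T\<^esub> y) = c (g x \<oplus>\<^bsub>?F\<^esub> g y) ?u"
        using xy by (simp only: f T.add.m_closed module_homD(2)[OF g])
      also have "\<dots> = f x \<oplus>\<^bsub>L\<^esub> f y"
        using xy by (simp only: f module_homD(2)[OF c2[OF u]] module_homD(1)[OF g])
      finally show "f (x \<oplus>\<^bsub>T\<^esub> y) = f x \<oplus>\<^bsub>L\<^esub> f y" .
    next
      fix a x assume ax: "a \<in> carrier ?R" "x \<in> carrier T"
      have "f (a \<odot>\<^bsub>T\<^esub> x) = c (a \<odot>\<^bsub>?F\<^esub> g x) ?u"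
        using ax by (simp only: f T.smult_closed module_homD(3)[OF g])
      also have "\<dots> = a \<odot>\<^bsub>L\<^esub> f x"
        using ax by (simp only: f module_homD(3)[OF c2[OF u]] module_homD(1)[OF g])
      finally show "f (a \<odot>\<^bsub>T\<^esub> x) = a \<odot>\<^bsub>L\<^esub> f x" .
    qed
    have fb: "f (b v w) = c v w" if v: "v \<in> carrier ?F" and w: "w \<in> carrier ?F" for v w
    proof -
      have "f (b v w) = c (w 0 \<odot>\<^bsub>?F\<^esub> v) ?u"
        using module_homD(1)[OF hom1[OF v] w] gh[OF prodF[OF v], of w] prod_smult(2)[OF v w]
        by (simp only: f b_def)
      also have "\<dots> = w 0 \<odot>\<^bsub>L\<^esub> c v ?u"
        using module_homD(3)[OF c2[OF u] _ v] by simp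
      also have "\<dots> = c v (w 0 \<odot>\<^bsub>?F\<^esub> ?u)"
        using module_homD(3)[OF c1[OF v] _ u] by simp
      also have "w 0 \<odot>\<^bsub>?F\<^esub> ?u = w"
        using w by (auto simp: unit_vec_def)
      finally show ?thesis .
    qed
    have uniq: "f' = f" if f': "f' \<in> module_hom ?R T L" "f' \<in> extensional (carrier T)"
      "\<forall>x\<in>carrier ?F. \<forall>y\<in>carrier ?F. f' (b x y) = c x y" for f'
    proof (rule extensionalityI[OF f'(2)])
      show "f \<in> extensional (carrier T)"
        by (simp add: f_def)
      fix x assume x: "x \<in> carrier T"
      have gx: "g x \<in> carrier ?F"
        by (rule module_homD(1)[OF g x])
      have "(\<lambda>i. g x i * ?u i) = g x"
        using gx by (auto simp: unit_vec_def)
      then have "b (g x) ?u = x"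
        by (simp add: b_def hg[OF x])
      then show "f' x = f x"
        using f'(3) gx u f[OF x] by metis
    qed
    show ?thesis
    proof (rule ex1I[of _ f])
      show "f \<in> module_hom ?R T L \<inter> extensional (carrier T) \<and>
          (\<forall>x\<in>carrier ?F. \<forall>y\<in>carrier ?F. f (b x y) = c x y)"
        using fhom fb by (simp add: f_def)
    qed (use uniq in blast)
  qed
  then show ?thesis
    unfolding tensor_product_def using T b by blast
qed

text \<open>All line bundles form a single class. It is its own square, as each of its members is a
  tensor product of two copies of the free module of rank one.\<close>

lemma trivial_Pic_if_line_bundles_free:
  assumes free: "\<And>M. M \<in> line_bundles (ring_of TYPE('a::comm_ring_1)) \<Longrightarrow>
    module_iso (ring_of TYPE('a)) (free_module (ring_of TYPE('a)) 1) M"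
  shows "trivial_group (Pic (ring_of TYPE('a)))"
proof -
  let ?R = "ring_of TYPE('a)" and ?F = "free_module (ring_of TYPE('a)) 1"
  let ?L = "line_bundles (ring_of TYPE('a))"
  have class_eq: "iso_class ?R M = ?L" if "M \<in> ?L" for M
  proof -
    have "module_iso ?R M ?F"
      by (rule module_iso_sym[OF module_free_module free[OF that]])
    then show ?thesis
      unfolding iso_class_def using module_iso_trans free by blast
  qed
  have one: "one (Pic ?R) = ?L"
    using class_eq[OF line_bundle_free] by (simp add: Pic_def)
  have carrier: "carrier (Pic ?R) = {?L}"
    using class_eq line_bundle_free by (force simp: Pic_def)
  have mult: "?L \<otimes>\<^bsub>Pic ?R\<^esub> ?L = ?L"
    using tensor_product_free_1[OF line_bundle_module free] line_bundle_free
    by (auto simp: Pic_def)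
  have "group (Pic ?R)"
    by (rule groupI) (simp_all add: one carrier mult)
  then show ?thesis
    by (simp add: trivial_group_def one carrier)
qed

section \<open>The column module of a singular matrix\<close>

definition column_vec :: "'a::comm_ring_1 ^ 2 ^ 2 \<Rightarrow> 'a \<Rightarrow> 'a \<Rightarrow> nat \<Rightarrow> 'a"
  where "column_vec A x y i = (if i = 0 then A$1$1 * x + A$1$2 * y
    else if i = 1 then A$2$1 * x + A$2$2 * y else 0)"

text \<open>Realised inside \<open>nat \<Rightarrow> 'a\<close> because \<open>line_bundles\<close>
  and \<open>Pic\<close> consist of modules with carriers in that type.\<close>

definition column_module :: "'a::comm_ring_1 ^ 2 ^ 2 \<Rightarrow> ('a, nat \<Rightarrow> 'a) module"
  where "column_module A =
    free_module (ring_of TYPE('a)) 2\<lparr>carrier := {column_vec A x y | x y. True}\<rparr>"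

lemma column_module_sel [simp]:
  "carrier (column_module (A :: 'a::comm_ring_1 ^ 2 ^ 2)) = {column_vec A x y | x y. True}"
  "ring.zero (column_module A) = (\<lambda>i. 0)"
  "add (column_module A) = (\<lambda>v w i. v i + w i)"
  "module.smult (column_module A) = (\<lambda>a v i. a * v i)"
  by (simp_all add: column_module_def)

lemma column_vec_add:
  "(\<lambda>i. column_vec A x y i + column_vec A x' y' i) = column_vec A (x + x') (y + y')"
  by (auto simp: column_vec_def algebra_simps)

lemma column_vec_smult:
  "(\<lambda>i. r * column_vec A x y i) = column_vec A (r * x) (r * y)"
  by (auto simp: column_vec_def algebra_simps)

lemma module_column_module:
  "Module.module (ring_of TYPE('a)) (column_module (A :: 'a::comm_ring_1 ^ 2 ^ 2))"
  unfolding column_module_def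
proof (rule module_free_submodule)
  have "(\<lambda>i. 0) = column_vec A 0 0"
    by (auto simp: column_vec_def)
  then show "(\<lambda>i. 0) \<in> {column_vec A x y | x y. True}"
    by blast
next
  fix v w assume "v \<in> {column_vec A x y | x y. True}" "w \<in> {column_vec A x y | x y. True}"
  then show "(\<lambda>i. v i + w i) \<in> {column_vec A x y | x y. True}"
    using column_vec_add by blast
next
  fix a v assume "v \<in> {column_vec A x y | x y. True}"
  then show "(\<lambda>i. a * v i) \<in> {column_vec A x y | x y. True}"
    using column_vec_smult by blast
qed

text \<open>Multiplicativity of the determinant: the minor of two image vectors is
  \<open>det A\<close> times the minor of their arguments.\<close>

lemma column_vec_proportional:
  assumes "det A = 0"
  shows "column_vec A x y i * column_vec A x' y' j = column_vec A x' y' i * column_vec A x y j"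
proof -
  have "(A$1$1 * x + A$1$2 * y) * (A$2$1 * x' + A$2$2 * y') =
      (A$1$1 * x' + A$1$2 * y') * (A$2$1 * x + A$2$2 * y) + det A * (x * y' - x' * y)"
    for x y x' y'
    by (simp add: det_2 algebra_simps)
  with assms show ?thesis
    by (auto simp: column_vec_def mult.commute)
qed

text \<open>With \<open>m = column_vec A x0 y0\<close>, proportionality gives
  \<open>m k * v = v k * m\<close>, so \<open>m\<close> generates wherever \<open>m k\<close> is
  invertible. It is free because it has a nonzero coordinate in a domain.\<close>

lemma rank_one_at_column_module:
  fixes A :: "'a::idom ^ 2 ^ 2"
  assumes P: "primeideal P (ring_of TYPE('a))"
    and det: "det A = 0" and s: "column_vec A x0 y0 k \<notin> P"
  shows "rank_one_at (ring_of TYPE('a)) (column_module A) P"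
  unfolding rank_one_at_def
proof (intro bexI[of _ "column_vec A x0 y0"] conjI ballI impI)
  fix v assume "v \<in> carrier (column_module A)"
  then obtain x y where v: "v = column_vec A x y"
    by auto
  show "\<exists>s\<in>carrier (ring_of TYPE('a)) - P. \<exists>r\<in>carrier (ring_of TYPE('a)).
      s \<odot>\<^bsub>column_module A\<^esub> v = r \<odot>\<^bsub>column_module A\<^esub> column_vec A x0 y0"
    using s by (intro bexI[of _ "column_vec A x0 y0 k"] bexI[of _ "v k"])
      (auto simp: v column_vec_proportional[OF det])
next
  have 0: "0 \<in> P" "1 \<notin> P"
    using P by (simp_all add: primeideal_iff ideal_iff)
  fix r assume "\<exists>s\<in>carrier (ring_of TYPE('a)) - P.
    s \<odot>\<^bsub>column_module A\<^esub> (r \<odot>\<^bsub>column_module A\<^esub> column_vec A x0 y0) = \<zero>\<^bsub>column_module A\<^esub>"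
  then obtain t where t: "t \<notin> P" "(\<lambda>i. t * (r * column_vec A x0 y0 i)) = (\<lambda>i. 0)"
    by auto
  have "t \<noteq> 0" "column_vec A x0 y0 k \<noteq> 0"
    using t(1) s 0 by metis+
  then have "r = 0"
    using fun_cong[OF t(2), of k] by simp
  then show "\<exists>s\<in>carrier (ring_of TYPE('a)) - P. s \<otimes>\<^bsub>ring_of TYPE('a)\<^esub> r = \<zero>\<^bsub>ring_of TYPE('a)\<^esub>"
    using 0 by (intro bexI[of _ 1]) auto
qed auto

text \<open>Let \<open>W\<close> have the rows \<open>(p, r)\<close> and \<open>(q, s)\<close>.
  Unimodularity says that \<open>A W\<close> has trace one, and \<open>det A = 0\<close> gives
  \<open>A W A = tr (A W) A\<close>, so \<open>g = A W\<close> fixes the columns. At each prime some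
  entry of \<open>A\<close> is a unit, and its column is a local basis.\<close>

lemma line_bundle_column_module:
  fixes A :: "'a::idom ^ 2 ^ 2"
  assumes A: "A \<in> UmM2" and det: "det A = 0"
  shows "column_module A \<in> line_bundles (ring_of TYPE('a))"
proof -
  let ?R = "ring_of TYPE('a)"
  define a b c d where "a = A$1$1" and "b = A$1$2" and "c = A$2$1" and "d = A$2$2"
  note abcd = this
  have ad: "a * d = b * c"
    using det by (simp add: det_2 abcd)
  obtain p q r s where pqrs: "a * p + b * q + (c * r + d * s) = 1"
    using A unfolding UmM2_iff abcd by blast
  have vec: "column_vec A x y i = (if i = 0 then a * x + b * y else if i = 1 then c * x + d * y else 0)"
    for x y i
    by (simp add: column_vec_def abcd)
  define g where "g v = column_vec A (p * v 0 + r * v 1) (q * v 0 + s * v 1)" for v :: "nat \<Rightarrow> 'a"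
  have g_eq: "g (column_vec A x y) = column_vec A x y" for x y
  proof -
    let ?v = "a * x + b * y" and ?w = "c * x + d * y"
    have "a * (p * ?v + r * ?w) + b * (q * ?v + s * ?w) =
        (a * p + b * q + (c * r + d * s)) * ?v + (a * d - b * c) * (r * y - s * x)"
      by (simp add: algebra_simps)
    moreover have "c * (p * ?v + r * ?w) + d * (q * ?v + s * ?w) =
        (a * p + b * q + (c * r + d * s)) * ?w + (a * d - b * c) * (q * x - p * y)"
      by (simp add: algebra_simps)
    ultimately show ?thesis
      unfolding g_def by (auto simp: vec pqrs ad)
  qed
  have id: "id \<in> module_hom ?R (column_module A) (free_module ?R 2)"
    by (rule module_homI) (auto simp: vec)
  have g: "g \<in> module_hom ?R (free_module ?R 2) (column_module A)"
  proof (rule module_homI)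
    fix v w :: "nat \<Rightarrow> 'a"
    show "g (v \<oplus>\<^bsub>free_module ?R 2\<^esub> w) = g v \<oplus>\<^bsub>column_module A\<^esub> g w"
      unfolding g_def column_module_sel column_vec_add by (simp add: algebra_simps)
  next
    fix a and v :: "nat \<Rightarrow> 'a"
    show "g (a \<odot>\<^bsub>free_module ?R 2\<^esub> v) = a \<odot>\<^bsub>column_module A\<^esub> g v"
      unfolding g_def column_module_sel column_vec_smult by (simp add: algebra_simps)
  qed (auto simp: g_def)
  have "fg_projective ?R (column_module A)"
    unfolding fg_projective_def
    by (intro conjI module_column_module exI[of _ 2] bexI[OF _ id] bexI[OF _ g]) (auto simp: g_eq)
  moreover have "rank_one_at ?R (column_module A) P" if P: "primeideal P ?R" for P
  proof -
    have "\<not> (\<forall>i j. A $ i $ j \<in> P)"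
      using A P unfolding UmM2_prime_iff by blast
    then consider "a \<notin> P" | "b \<notin> P" | "c \<notin> P" | "d \<notin> P"
      unfolding forall_2 abcd by blast
    then show ?thesis
    proof cases
      case 1
      then show ?thesis
        by (intro rank_one_at_column_module[OF P det, of 1 0 0]) (simp add: vec)
    next
      case 2
      then show ?thesis
        by (intro rank_one_at_column_module[OF P det, of 0 1 0]) (simp add: vec)
    next
      case 3
      then show ?thesis
        by (intro rank_one_at_column_module[OF P det, of 1 0 1]) (simp add: vec)
    next
      case 4
      then show ?thesis
        by (intro rank_one_at_column_module[OF P det, of 0 1 1]) (simp add: vec)
    qed
  qed
  ultimately show ?thesis
    by (simp add: line_bundles_def rank_one_projective_def)
qed

text \<open>A generator \<open>(p, q)\<close> of the column module factors \<open>A\<close> as a column times a row.\<close>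

lemma simply_extendable_if_column_module_free:
  fixes A :: "'a::comm_ring_1 ^ 2 ^ 2"
  assumes A: "A \<in> UmM2"
    and iso: "module_iso (ring_of TYPE('a)) (free_module (ring_of TYPE('a)) 1) (column_module A)"
  shows "simply_extendable A"
proof -
  let ?R = "ring_of TYPE('a)" and ?F = "free_module (ring_of TYPE('a)) 1"
  define a b c d where "a = A$1$1" and "b = A$1$2" and "c = A$2$1" and "d = A$2$2"
  note abcd = this
  have vec: "column_vec A x y i = (if i = 0 then a * x + b * y else if i = 1 then c * x + d * y else 0)"
    for x y i
    by (simp add: column_vec_def abcd)
  obtain x1 x2 x3 x4 where one: "a * x1 + b * x2 + (c * x3 + d * x4) = 1"
    using A unfolding UmM2_iff abcd by blast
  obtain h where h: "h \<in> module_hom ?R ?F (column_module A)"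
    and bij: "bij_betw h (carrier ?F) (carrier (column_module A))"
    using iso unfolding module_iso_def by blast
  have u: "unit_vec 0 \<in> carrier ?F"
    by (simp add: unit_vec_def)
  obtain x y where m: "h (unit_vec 0) = column_vec A x y"
    using module_homD(1)[OF h u] by auto
  have gen: "\<exists>r. column_vec A x' y' = (\<lambda>i. r * column_vec A x y i)" for x' y'
  proof -
    have "column_vec A x' y' \<in> h ` carrier ?F"
      unfolding bij_betw_imp_surj_on[OF bij] by auto
    then obtain v where v: "column_vec A x' y' = h v" "v \<in> carrier ?F"
      by (rule imageE)
    have "v 0 \<odot>\<^bsub>?F\<^esub> unit_vec 0 = v"
      using v(2) by (auto simp: unit_vec_def)
    then have "h v = v 0 \<odot>\<^bsub>column_module A\<^esub> h (unit_vec 0)"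
      using module_homD(3)[OF h _ u, of "v 0"] by (simp only: ring_of_sel UNIV_I)
    then show ?thesis
      unfolding v(1) m by auto
  qed
  obtain r s where r: "column_vec A 1 0 = (\<lambda>i. r * column_vec A x y i)"
    and s: "column_vec A 0 1 = (\<lambda>i. s * column_vec A x y i)"
    using gen by metis
  define p q where "p = a * x + b * y" and "q = c * x + d * y"
  have "a = r * p" "c = r * q"
    using fun_cong[OF r, of 0] fun_cong[OF r, of 1] by (simp_all add: vec p_def q_def)
  moreover have "b = s * p" "d = s * q"
    using fun_cong[OF s, of 0] fun_cong[OF s, of 1] by (simp_all add: vec p_def q_def)
  moreover have "(r * x1 + s * x2) * p + (r * x3 + s * x4) * q =
      (r * p) * x1 + (s * p) * x2 + ((r * q) * x3 + (s * q) * x4)"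
    by (simp add: algebra_simps)
  ultimately have "(r * x1 + s * x2) * p + (r * x3 + s * x4) * q = 1"
    using one by simp
  then show ?thesis
    unfolding simply_extendable_iff p_def q_def abcd by blast
qed

lemma Pi2_ring_if_trivial_Pic:
  assumes "trivial_group (Pic (ring_of TYPE('a::idom)))"
  shows "Pi2_ring TYPE('a)"
  unfolding Pi2_ring_def
proof (intro ballI impI)
  let ?R = "ring_of TYPE('a)"
  fix A :: "'a ^ 2 ^ 2" assume A: "A \<in> UmM2" and det: "det A = 0"
  have L: "column_module A \<in> line_bundles ?R"
    by (rule line_bundle_column_module[OF A det])
  have "iso_class ?R (column_module A) = iso_class ?R (free_module ?R 1)"
    using assms L unfolding trivial_group_def Pic_def by auto
  moreover have "column_module A \<in> iso_class ?R (column_module A)"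
    using L module_iso_refl by (auto simp: iso_class_def)
  ultimately have "module_iso ?R (free_module ?R 1) (column_module A)"
    by (simp add: iso_class_def)
  then show "extendable A"
    using simply_extendable_if_column_module_free[OF A] simply_extendable_imp_extendable by blast
qed

theorem theorem1p12:
  assumes "krull_dim (ring_of TYPE('a::idom)) = 1"
  shows "(\<forall>A\<in>(UmM2 :: ('a ^ 2 ^ 2) set). det A \<noteq> 0 \<longrightarrow> simply_extendable A) \<and>
    (SE2_tri_ring TYPE('a) \<and> V2_ring TYPE('a) \<and> Z2_ring TYPE('a)) \<and>
    ((Pi2_ring TYPE('a) \<longleftrightarrow> SE2_ring TYPE('a)) \<and>
     (Pi2_ring TYPE('a) \<longleftrightarrow> E2_ring TYPE('a)) \<and>
     (Pi2_ring TYPE('a) \<longleftrightarrow> trivial_group (Pic (ring_of TYPE('a))))) \<and>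
    (dedekind_domain TYPE('a) \<longrightarrow>
      (Pi2_ring TYPE('a) \<longleftrightarrow> principal_domain (ring_of TYPE('a))))"
proof (intro conjI impI)
  show nonzero: "\<forall>A\<in>(UmM2 :: ('a ^ 2 ^ 2) set). det A \<noteq> 0 \<longrightarrow> simply_extendable A"
    using det_nonzero_imp_simply_extendable[OF assms] by blast
  show SE2_tri: "SE2_tri_ring TYPE('a)"
    by (rule SE2_tri_ring_if_dim_1[OF assms])
  show "V2_ring TYPE('a)"
    by (rule V2_ring_if_SE2_tri_ring[OF SE2_tri])
  show "Z2_ring TYPE('a)"
    using Z2_ring_if_simply_extendable nonzero by blast
  \<comment> \<open>Matrices of nonzero determinant are already settled; for determinant zero both
    kinds of extension agree.\<close>
  have "Pi2_ring TYPE('a) \<Longrightarrow> SE2_ring TYPE('a)"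
    unfolding Pi2_ring_def SE2_ring_def using nonzero extendable_imp_simply_extendable by blast
  moreover have "SE2_ring TYPE('a) \<Longrightarrow> E2_ring TYPE('a)"
    unfolding SE2_ring_def E2_ring_def using simply_extendable_imp_extendable by blast
  moreover have "E2_ring TYPE('a) \<Longrightarrow> Pi2_ring TYPE('a)"
    unfolding Pi2_ring_def E2_ring_def by blast
  ultimately show "Pi2_ring TYPE('a) \<longleftrightarrow> SE2_ring TYPE('a)" "Pi2_ring TYPE('a) \<longleftrightarrow> E2_ring TYPE('a)"
    by blast+
  have "trivial_group (Pic (ring_of TYPE('a)))" if "Pi2_ring TYPE('a)"
  proof (rule trivial_Pic_if_line_bundles_free)
    fix M :: "('a, nat \<Rightarrow> 'a) module" assume "M \<in> line_bundles (ring_of TYPE('a))"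
    then show "module_iso (ring_of TYPE('a)) (free_module (ring_of TYPE('a)) 1) M"
      by (intro line_bundle_trivial[OF assms that]) (simp add: line_bundles_def)
  qed
  then show "Pi2_ring TYPE('a) \<longleftrightarrow> trivial_group (Pic (ring_of TYPE('a)))"
    using Pi2_ring_if_trivial_Pic by blast
  show "Pi2_ring TYPE('a) \<longleftrightarrow> principal_domain (ring_of TYPE('a))" if "dedekind_domain TYPE('a)"
    using principal_domain_if_Pi2_ring[OF assms that] Pi2_ring_if_principal_domain by blast
qed

end
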